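(* Consider a cache-aided wireless network (as defined in the context) with $M$ edge nodes, each with fractional cache size $\mu\in[1/M,1]$, $K$ users and a library of $N\geq K$ files, with perfect channel state information at both edge nodes and users. Then the minimum normalized delivery time satisfies \[ \delta^*(\mu)\;\geq\;\max_{\ell\in\{1,\ldots,\min\{M,K\}\}}\frac{K-(M-\ell)^+(K-\ell)^+\mu}{\ell}, \] where $(x)^+=\max\{0,x\}$.
   Context: Cache-aided wireless network: there are $M$ edge nodes $\mathrm{EN}_1,\dots,\mathrm{EN}_M$, $K$ users, and a library of $N$ files $F_1,\dots,F_N$, each of $L$ bits, i.i.d. uniform on $\{1,\dots,2^L\}$. Each edge node has a cache of $\mu N L$ bits, $\mu\in[1/M,1]$ (the fractional cache size). The channel coefficient from $\mathrm{EN}_m$ to user $k$ is $h_{km}\in\mathbb{C}$, drawn i.i.d. from a continuous distribution and constant within a transmission interval; $\mathbf H=\{h_{km}\}$. A policy consists of: (a) a caching policy: $\mathrm{EN}_m$ stores $S_{m,n}=\pi_c^m(F_n)$ for each $n$, with $H(S_{m,n})\le \mu L$ (coding within a file allowed, no inter-file coding), and $S_m=(S_{m,1},\dots,S_{m,N})$; the caching policy does not depend on demands or channels. (b) an edge transmission policy: given a demand vector $\mathbf D=(d_1,\dots,d_K)\in\{1,\dots,N\}^K$ (user $k$ requests $F_{d_k}$) and the global channel $\mathbf H$, $\mathrm{EN}_m$ transmits $(X_m[t])_{t=1}^{T^{(\mathbf D,\mathbf H)}}=\pi_e^m(S_m,\mathbf D,\mathbf H)$, subject to $E[(X_m[t]-E[X_m[t]])^2]\le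 P$ for all $t$. (c) user $k$ receives $Y_k[t]=\sum_{m=1}^M h_{km}X_m[t]+n_k[t]$ with $n_k[t]\sim\mathcal N(0,1)$ i.i.d. over time and users, and outputs an estimate $\hat F_{d_k}=\pi_d^k((Y_k[t])_{t},\mathbf D,\mathbf H)$. The error probability is $P_e=\max_{\mathbf D}\max_k \mathbb P(\hat F_{d_k}\ne F_{d_k})$; a policy is feasible if for almost all $\mathbf H$, $P_e\to 0$ as $L\to\infty$. Perfect CSI means $\mathbf H$ is known to all edge nodes and users. For a feasible policy, the delivery time per bit is $\Delta(\mu,P)=\max_{\mathbf D}\limsup_{L\to\infty}E_{\mathbf H}[T^{(\mathbf D,\mathbf H)}]/L$, its normalized delivery time (NDT) is $\delta(\mu)=\lim_{P\to\infty}\Delta(\mu,P)/(1/\log P)$, and the minimum NDT is $\delta^*(\mu)=\inf\{\delta(\mu):\delta(\mu)\text{ achievable by a feasible policy}\}$. *)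

theory Defs
  imports "HOL-Probability.Probability"
begin

text \<open>Indexing conventions: edge nodes m < M, users k < K, files n < N,
  time slots t < T. Channel H :: nat \<times> nat \<Rightarrow> complex, H (k,m) = h_km.
  Files take values in {1..2^L}. Demand vectors D :: nat \<Rightarrow> nat with D k < N.\<close>

definition pos_part :: "real \<Rightarrow> real" where
  "pos_part x = max 0 x"

definition pmf_entropy_bits :: "'a pmf \<Rightarrow> real" where
  "pmf_entropy_bits p = - (\<Sum>x\<in>set_pmf p. pmf p x * log 2 (pmf p x))"

definition cvariance :: "complex pmf \<Rightarrow> real" where
  "cvariance p = measure_pmf.expectation p
     (\<lambda>x. (cmod (x - measure_pmf.expectation p (\<lambda>y. y)))\<^sup>2)"

definition file_pmf :: "nat \<Rightarrow> nat \<Rightarrow> (nat \<Rightarrow> nat) pmf" where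
  "file_pmf N L = Pi_pmf {..<N} 0 (\<lambda>_. pmf_of_set {1..2^L})"

definition cnormal :: "complex measure" where
  "cnormal = distr
     (density lborel (normal_density 0 (sqrt (1/2))) \<Otimes>\<^sub>M
      density lborel (normal_density 0 (sqrt (1/2))))
     borel (\<lambda>(a,b). Complex a b)"

definition chan_measure :: "nat \<Rightarrow> nat \<Rightarrow> complex measure \<Rightarrow> (nat \<times> nat \<Rightarrow> complex) measure" where
  "chan_measure M K \<nu> = PiM ({..<K} \<times> {..<M}) (\<lambda>_. \<nu>)"

definition noise_measure :: "nat \<Rightarrow> nat \<Rightarrow> (nat \<times> nat \<Rightarrow> complex) measure" where
  "noise_measure K T = PiM ({..<K} \<times> {..<T}) (\<lambda>_. cnormal)"

definition demands :: "nat \<Rightarrow> nat \<Rightarrow> (nat \<Rightarrow> nat) set" where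
  "demands K N = PiE {..<K} (\<lambda>_. {..<N})"

text \<open>A policy for a fixed file size L:
  cache m f = S_{m,n} when F_n = f (caching policy of EN_m);
  blocklen D H = T^(D,H);
  enc m S_m D H t = X_m[t];
  dec k Y D H = estimate of F_{d_k} at user k.\<close>
record policy =
  cache :: "nat \<Rightarrow> nat \<Rightarrow> nat"
  blocklen :: "(nat \<Rightarrow> nat) \<Rightarrow> (nat \<times> nat \<Rightarrow> complex) \<Rightarrow> nat"
  enc :: "nat \<Rightarrow> (nat \<Rightarrow> nat) \<Rightarrow> (nat \<Rightarrow> nat) \<Rightarrow> (nat \<times> nat \<Rightarrow> complex) \<Rightarrow> nat \<Rightarrow> complex"
  dec :: "nat \<Rightarrow> (nat \<Rightarrow> complex) \<Rightarrow> (nat \<Rightarrow> nat) \<Rightarrow> (nat \<times> nat \<Rightarrow> complex) \<Rightarrow> nat"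

definition cache_content :: "policy \<Rightarrow> nat \<Rightarrow> nat \<Rightarrow> (nat \<Rightarrow> nat) \<Rightarrow> (nat \<Rightarrow> nat)" where
  "cache_content pol N m F = restrict (\<lambda>n. cache pol m (F n)) {..<N}"

definition received ::
  "policy \<Rightarrow> nat \<Rightarrow> nat \<Rightarrow> nat \<Rightarrow> (nat \<Rightarrow> nat) \<Rightarrow> (nat \<Rightarrow> nat) \<Rightarrow> (nat \<times> nat \<Rightarrow> complex)
     \<Rightarrow> (nat \<times> nat \<Rightarrow> complex) \<Rightarrow> (nat \<Rightarrow> complex)" where
  "received pol M N k F D H z = restrict
     (\<lambda>t. (\<Sum>m<M. H (k,m) * enc pol m (cache_content pol N m F) D H t) + z (k,t))
     {..<blocklen pol D H}"

definition error_prob ::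
  "policy \<Rightarrow> nat \<Rightarrow> nat \<Rightarrow> nat \<Rightarrow> nat \<Rightarrow> nat \<Rightarrow> (nat \<Rightarrow> nat) \<Rightarrow> (nat \<times> nat \<Rightarrow> complex) \<Rightarrow> real" where
  "error_prob pol M K N L k D H =
     measure_pmf.expectation (file_pmf N L)
       (\<lambda>F. measure (noise_measure K (blocklen pol D H))
          {z \<in> space (noise_measure K (blocklen pol D H)).
             dec pol k (received pol M N k F D H z) D H \<noteq> F (D k)})"

definition Pe :: "policy \<Rightarrow> nat \<Rightarrow> nat \<Rightarrow> nat \<Rightarrow> nat \<Rightarrow> (nat \<times> nat \<Rightarrow> complex) \<Rightarrow> real" where
  "Pe pol M K N L H = (MAX Dk \<in> demands K N \<times> {..<K}. error_prob pol M K N L (snd Dk) (fst Dk) H)"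

definition valid_policy ::
  "nat \<Rightarrow> nat \<Rightarrow> nat \<Rightarrow> real \<Rightarrow> complex measure \<Rightarrow> real \<Rightarrow> nat \<Rightarrow> policy \<Rightarrow> bool" where
  "valid_policy M K N \<mu> \<nu> P L pol \<longleftrightarrow>
     (\<forall>m<M. pmf_entropy_bits (map_pmf (cache pol m) (pmf_of_set {1..2^L})) \<le> \<mu> * real L) \<and>
     (\<forall>m<M. \<forall>D\<in>demands K N. \<forall>H\<in>space (chan_measure M K \<nu>). \<forall>t<blocklen pol D H.
        cvariance (map_pmf (\<lambda>F. enc pol m (cache_content pol N m F) D H t) (file_pmf N L)) \<le> P) \<and>
     (\<forall>k<K. \<forall>D\<in>demands K N. \<forall>H.
        (\<lambda>Y. dec pol k Y D H) \<in> measurable (PiM {..<blocklen pol D H} (\<lambda>_. borel)) (count_space UNIV)) \<and>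
     (\<forall>D\<in>demands K N. blocklen pol D \<in> measurable (chan_measure M K \<nu>) (count_space UNIV))"

definition feasible ::
  "nat \<Rightarrow> nat \<Rightarrow> nat \<Rightarrow> real \<Rightarrow> complex measure \<Rightarrow> real \<Rightarrow> (nat \<Rightarrow> policy) \<Rightarrow> bool" where
  "feasible M K N \<mu> \<nu> P pol \<longleftrightarrow>
     (\<forall>L. valid_policy M K N \<mu> \<nu> P L (pol L)) \<and>
     (AE H in chan_measure M K \<nu>. (\<lambda>L. Pe (pol L) M K N L H) \<longlonglongrightarrow> 0)"

definition delivery_time ::
  "nat \<Rightarrow> nat \<Rightarrow> nat \<Rightarrow> complex measure \<Rightarrow> (nat \<Rightarrow> policy) \<Rightarrow> ereal" where
  "delivery_time M K N \<nu> pol =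
     (MAX D \<in> demands K N.
        limsup (\<lambda>L. enn2ereal (\<integral>\<^sup>+ H. ennreal (real (blocklen (pol L) D H)) \<partial>chan_measure M K \<nu>)
                     / ereal (real L)))"

text \<open>delta is an achievable NDT: a family of feasible policies, one for each power P,
  whose delivery time Delta(P) satisfies Delta(P) / (1 / log P) \<longrightarrow> delta as P \<longrightarrow> \<infinity>.
  Logarithms are in bits (base 2), consistent with L measured in bits.\<close>
definition achievable_NDT ::
  "nat \<Rightarrow> nat \<Rightarrow> nat \<Rightarrow> real \<Rightarrow> complex measure \<Rightarrow> ereal \<Rightarrow> bool" where
  "achievable_NDT M K N \<mu> \<nu> \<delta> \<longleftrightarrow>
     (\<exists>pol :: real \<Rightarrow> nat \<Rightarrow> policy.
        (\<forall>P>0. feasible M K N \<mu> \<nu> P (pol P)) \<and>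
        ((\<lambda>P. delivery_time M K N \<nu> (pol P) * ereal (log 2 P)) \<longlongrightarrow> \<delta>) at_top)"

definition min_NDT :: "nat \<Rightarrow> nat \<Rightarrow> nat \<Rightarrow> real \<Rightarrow> complex measure \<Rightarrow> ereal" where
  "min_NDT M K N \<mu> \<nu> = Inf {\<delta>. achievable_NDT M K N \<mu> \<nu> \<delta>}"

end

theory Submission
  imports Defs
begin

text \<open>
  Fix l and the channel H, and let user k request file k. Compare a correctly decoding system with
  a receiver that knows nothing about the requested files: it draws the observations of the first l
  users from a Gaussian of variance P and decodes their files, draws the cached contents at nodes
  m \<ge> l of the other requested files from their marginal laws, and draws the observations of the
  remaining users. For almost every H the latter are, up to noise whose variance does not depend
  on P, determined by the data already drawn, because the first l columns of H have rank l. Such a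
  receiver names all K requested files correctly with probability at most 2^(- K L). On the other
  hand, on the event of correct decoding its likelihood ratio against the true system is at least
  exp(-g), where the mean of g is at most
  (M - l) (K - l) \<mu> L ln 2 + T (l ln P + c(H)).
  The tangent inequality 1 + a \<le> exp(a - g) + g with a = K L ln 2 turns this into a lower
  bound on T without any differential entropies. Fatou's lemma, applied first as L tends to
  infinity and then along P = 2^n, integrates the bound over H even if the expectation of c(H)
  is infinite.
\<close>

section \<open>Complex Gaussian noise\<close>

text \<open>All likelihoods are taken relative to one reference measure, Lebesgue measure divided by
  pi. The true noise density relative to it is at most 1; replacing it by 1 makes the transmitted
  signal disappear and does the work of subtracting a noise entropy. The exponent g is minus the
  logarithm of the density of the guesses. It is nonnegative for P >= 1, and the tangent inequality
  needs only its mean, so neither concentration nor conditional entropy enters.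

  The unrequested files are given to the guessing receiver for free. Caching treats each file
  separately, so after decoding l files it lacks only the contents of nodes l, ..., M - 1 for files
  l, ..., K - 1; this is the origin of (M - l)(K - l). The inputs of nodes m < l need no guess,
  since they cancel in suitable combinations of the signals. The Gaussian guesses are centred at the
  mean because the power constraint bounds a variance.

  Encoders carry no measurability in H, so the converse is proved for one fixed H and only the block
  length is integrated over H. Feasibility gives one exceptional null set for each P; the sequence P
  = 2^n leaves countably many of them and puts Fatou's lemma within reach.\<close>

lemma lborel_complex:
  "(lborel :: complex measure) = distr (lborel \<Otimes>\<^sub>M lborel) borel (\<lambda>(a, b). Complex a b)"
proof (rule lborel_eqI)
  have [measurable]: "(\<lambda>(a, b). Complex a b) \<in> borel_measurable (lborel \<Otimes>\<^sub>M lborel)"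
    unfolding Complex_eq by measurable
  fix l u :: complex
  assume "\<And>b. b \<in> Basis \<Longrightarrow> l \<bullet> b \<le> u \<bullet> b"
  from this[of 1] this[of \<i>] have le: "Re l \<le> Re u" "Im l \<le> Im u"
    by (auto simp: Basis_complex_def inner_complex_def)
  have "(\<lambda>(a, b). Complex a b) -` box l u = box (Re l) (Re u) \<times> box (Im l) (Im u)"
    by (auto simp: box_def Basis_complex_def inner_complex_def)
  then have "emeasure (distr (lborel \<Otimes>\<^sub>M lborel) borel (\<lambda>(a, b). Complex a b)) (box l u) =
      emeasure (lborel \<Otimes>\<^sub>M lborel) (box (Re l) (Re u) \<times> box (Im l) (Im u))"
    by (subst emeasure_distr) (auto simp: space_pair_measure)
  also have "\<dots> = emeasure lborel (box (Re l) (Re u)) * emeasure lborel (box (Im l) (Im u))"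
    by (rule lborel.emeasure_pair_measure_Times) auto
  also have "\<dots> = (\<Prod>b\<in>Basis. (u - l) \<bullet> b)"
    using le by (simp add: Basis_complex_def inner_complex_def ennreal_mult)
  finally show "emeasure (distr (lborel \<Otimes>\<^sub>M lborel) borel (\<lambda>(a, b). Complex a b)) (box l u) =
      (\<Prod>b\<in>Basis. (u - l) \<bullet> b)" .
qed simp

lemma nn_integral_lborel_complex:
  assumes [measurable]: "f \<in> borel_measurable borel"
  shows "(\<integral>\<^sup>+ z. f z \<partial>lborel) = (\<integral>\<^sup>+ a. \<integral>\<^sup>+ b. f (Complex a b) \<partial>lborel \<partial>lborel)"
proof -
  have [measurable]: "(\<lambda>(a, b). Complex a b) \<in> borel_measurable (lborel \<Otimes>\<^sub>M lborel)"
    unfolding Complex_eq by measurable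
  have "(\<integral>\<^sup>+ z. f z \<partial>lborel) = (\<integral>\<^sup>+ p. f (case p of (a, b) \<Rightarrow> Complex a b) \<partial>(lborel \<Otimes>\<^sub>M lborel))"
    by (subst lborel_complex, subst nn_integral_distr) auto
  also have "\<dots> = (\<integral>\<^sup>+ a. \<integral>\<^sup>+ b. f (case (a, b) of (a, b) \<Rightarrow> Complex a b) \<partial>lborel \<partial>lborel)"
    by (rule lborel.nn_integral_fst[symmetric]) measurable
  finally show ?thesis by simp
qed

text \<open>Variance 1/2 in each real coordinate makes the normalising factors multiply to 1 / pi
  and the exponents add up to the squared modulus. The change of measure needs this form, a density
  on the plane itself, because there \<open>lborel\<close> is invariant under translation.\<close>

lemma cnormal_eq_density: "cnormal = density lborel (\<lambda>z. ennreal (exp (- (cmod z)\<^sup>2) / pi))"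
proof (rule measure_eqI)
  let ?d = "normal_density 0 (sqrt (1/2))"
  have [measurable]: "(\<lambda>(a, b). Complex a b) \<in> borel_measurable (lborel \<Otimes>\<^sub>M lborel)"
    "(\<lambda>(a, b). Complex a b) \<in> borel_measurable (density lborel f \<Otimes>\<^sub>M density lborel f)" for f
    unfolding Complex_eq by measurable
  have d: "?d a * ?d b = exp (- (cmod (Complex a b))\<^sup>2) / pi" for a b
    by (simp add: normal_density_def cmod_def exp_add[symmetric] real_sqrt_mult[symmetric] divide_simps add.commute)
  interpret d: prob_space "density lborel (\<lambda>x. ennreal (?d x))"
    by (rule prob_space_normal_density) simp
  fix A assume "A \<in> sets cnormal"
  then have [measurable]: "A \<in> sets borel" by (simp add: cnormal_def)
  have "emeasure cnormal A =
      (\<integral>\<^sup>+ p. indicator A (case p of (a, b) \<Rightarrow> Complex a b) \<partial>(density lborel ?d \<Otimes>\<^sub>M density lborel ?d))"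
    unfolding cnormal_def
    by (subst nn_integral_indicator[symmetric], simp, subst nn_integral_distr) auto
  also have "\<dots> = (\<integral>\<^sup>+ p. indicator A (case p of (a, b) \<Rightarrow> Complex a b)
      \<partial>density (lborel \<Otimes>\<^sub>M lborel) (\<lambda>(a, b). ennreal (?d a) * ennreal (?d b)))"
    by (subst pair_measure_density) (auto intro: d.sigma_finite_measure_axioms sigma_finite_lborel)
  also have "\<dots> = (\<integral>\<^sup>+ p. ennreal (exp (- (cmod (case p of (a, b) \<Rightarrow> Complex a b))\<^sup>2) / pi) *
      indicator A (case p of (a, b) \<Rightarrow> Complex a b) \<partial>(lborel \<Otimes>\<^sub>M lborel))"
    by (subst nn_integral_density)
       (auto intro!: nn_integral_cong simp: d ennreal_mult'[symmetric] split: prod.splits)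
  also have "\<dots> = (\<integral>\<^sup>+ z. ennreal (exp (- (cmod z)\<^sup>2) / pi) * indicator A z \<partial>lborel)"
    by (subst lborel_complex, subst nn_integral_distr) auto
  also have "\<dots> = emeasure (density lborel (\<lambda>z. ennreal (exp (- (cmod z)\<^sup>2) / pi))) A"
    by (subst emeasure_density) auto
  finally show "emeasure cnormal A = emeasure (density lborel (\<lambda>z. ennreal (exp (- (cmod z)\<^sup>2) / pi))) A" .
qed (simp add: cnormal_def)

text \<open>The factor 1 / pi is the peak of the density of \<open>cnormal\<close>. Relative to this
  measure that density is \<open>exp (- (cmod z)\<^sup>2)\<close>, hence at most 1, and a complex
  Gaussian with mean \<open>c\<close> and variance \<open>s\<close> has density
  \<open>exp (- (cmod (y - c))\<^sup>2 / s) / s\<close>.\<close>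

definition dominating :: "complex measure" where
  "dominating = density lborel (\<lambda>_. ennreal (1 / pi))"

lemma sets_cnormal [measurable_cong, simp]: "sets cnormal = sets borel"
  by (simp add: cnormal_def)

lemma sets_dominating [measurable_cong, simp]: "sets dominating = sets borel"
  by (simp add: dominating_def)

lemma sigma_finite_dominating: "sigma_finite_measure dominating"
  unfolding dominating_def
  by (subst sigma_finite_measure.sigma_finite_iff_density_finite[OF sigma_finite_lborel]) auto

lemma nn_integral_lborel_translate:
  fixes x :: "'a :: euclidean_space"
  assumes [measurable]: "f \<in> borel_measurable borel"
  shows "(\<integral>\<^sup>+ z. f (x + z) \<partial>lborel) = (\<integral>\<^sup>+ z. f z \<partial>lborel)"
  by (subst (2) lborel_distr_plus[of x, symmetric], subst nn_integral_distr) auto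

text \<open>Bounding the noise density by its peak leaves a multiple of Lebesgue measure, and
  translation invariance then removes \<open>x\<close>. As the right side is the same for every
  signal, observations caused by different file tuples can be compared under one measure.\<close>

lemma nn_integral_cnormal_translate_le:
  assumes [measurable]: "f \<in> borel_measurable borel"
  shows "(\<integral>\<^sup>+ z. f (x + z) \<partial>cnormal) \<le> (\<integral>\<^sup>+ z. f z \<partial>dominating)"
proof -
  have "(\<integral>\<^sup>+ z. f (x + z) \<partial>cnormal) = (\<integral>\<^sup>+ z. ennreal (exp (- (cmod z)\<^sup>2) / pi) * f (x + z) \<partial>lborel)"
    unfolding cnormal_eq_density by (subst nn_integral_density) auto
  also have "\<dots> \<le> (\<integral>\<^sup>+ z. ennreal (1 / pi) * f (x + z) \<partial>lborel)"
    by (intro nn_integral_mono mult_right_mono ennreal_leI divide_right_mono) auto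
  also have "\<dots> = (\<integral>\<^sup>+ z. f z \<partial>dominating)"
    unfolding dominating_def by (subst nn_integral_density) (auto simp: nn_integral_cmult nn_integral_lborel_translate)
  finally show ?thesis .
qed

lemma nn_integral_gaussian_real:
  assumes s: "s > 0"
  shows "(\<integral>\<^sup>+ a. ennreal (exp (- a\<^sup>2 / s)) \<partial>lborel) = ennreal (sqrt (pi * s))"
proof -
  have "(\<integral>\<^sup>+ a. ennreal (exp (- a\<^sup>2 / s)) \<partial>lborel) =
      (\<integral>\<^sup>+ a. ennreal (sqrt (pi * s)) * ennreal (normal_density 0 (sqrt (s/2)) a) \<partial>lborel)"
    using s by (intro nn_integral_cong, subst ennreal_mult'[symmetric])
      (auto simp: normal_density_def field_simps)
  also have "\<dots> = ennreal (sqrt (pi * s)) * (\<integral>\<^sup>+ a. ennreal (normal_density 0 (sqrt (s/2)) a) \<partial>lborel)"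
    by (rule nn_integral_cmult) auto
  also have "(\<integral>\<^sup>+ a. ennreal (normal_density 0 (sqrt (s/2)) a) \<partial>lborel) = 1"
    using s by (subst nn_integral_eq_integral) auto
  finally show ?thesis by simp
qed

lemma nn_integral_dominating_gaussian:
  assumes s: "s > 0"
  shows "(\<integral>\<^sup>+ y. ennreal (exp (- (cmod (y - c))\<^sup>2 / s)) \<partial>dominating) = ennreal s"
proof -
  have "(\<integral>\<^sup>+ y. ennreal (exp (- (cmod (y - c))\<^sup>2 / s)) \<partial>lborel) =
      (\<integral>\<^sup>+ y. ennreal (exp (- (cmod y)\<^sup>2 / s)) \<partial>lborel)"
    using nn_integral_lborel_translate[of "\<lambda>y. ennreal (exp (- (cmod (y - c))\<^sup>2 / s))" c] by simp
  also have "\<dots> = (\<integral>\<^sup>+ a. \<integral>\<^sup>+ b. ennreal (exp (- a\<^sup>2 / s)) * ennreal (exp (- b\<^sup>2 / s)) \<partial>lborel \<partial>lborel)"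
    by (subst nn_integral_lborel_complex)
       (auto intro!: nn_integral_cong simp: cmod_def ennreal_mult'[symmetric] exp_add[symmetric] diff_divide_distrib)
  also have "\<dots> = ennreal (sqrt (pi * s)) * ennreal (sqrt (pi * s))"
    using s nn_integral_gaussian_real[OF s] by (simp add: nn_integral_cmult nn_integral_multc)
  also have "\<dots> = ennreal (pi * s)"
    using s by (simp add: ennreal_mult'[symmetric])
  finally have "(\<integral>\<^sup>+ y. ennreal (exp (- (cmod (y - c))\<^sup>2 / s)) \<partial>lborel) = ennreal (pi * s)" .
  moreover have "(\<integral>\<^sup>+ y. ennreal (exp (- (cmod (y - c))\<^sup>2 / s)) \<partial>dominating) =
      ennreal (1 / pi) * (\<integral>\<^sup>+ y. ennreal (exp (- (cmod (y - c))\<^sup>2 / s)) \<partial>lborel)"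
    unfolding dominating_def by (subst nn_integral_density, simp, simp, rule nn_integral_cmult) simp
  ultimately show ?thesis
    using s by (simp only:) (simp add: ennreal_mult'[symmetric] del: ennreal_mult_divide_eq)
qed

lemma prob_space_cnormal: "prob_space cnormal"
proof
  have "emeasure cnormal (space cnormal) = (\<integral>\<^sup>+ y. ennreal (exp (- (cmod (y - 0))\<^sup>2 / 1)) \<partial>dominating)"
    unfolding cnormal_eq_density dominating_def
    by (subst emeasure_density, simp, simp, subst nn_integral_density)
       (auto intro!: nn_integral_cong simp: ennreal_mult'[symmetric])
  also have "\<dots> = 1" by (subst nn_integral_dominating_gaussian) auto
  finally show "emeasure cnormal (space cnormal) = 1" .
qed

text \<open>The exact value is 1; any finite bound suffices.\<close>

lemma nn_integral_cnormal_square_le: "(\<integral>\<^sup>+ z. ennreal ((cmod z)\<^sup>2) \<partial>cnormal) \<le> 4"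
proof -
  have *: "t * exp (- t) \<le> 2 * exp (- t / 2)" for t :: real
  proof -
    have "t / 2 \<le> exp (t / 2)" using exp_ge_add_one_self[of "t/2"] by linarith
    then have "t \<le> 2 * exp (t/2)" by linarith
    then have "t * exp (- t) \<le> 2 * exp (t/2) * exp (- t)" by (rule mult_right_mono) simp
    also have "\<dots> = 2 * exp (- t / 2)" by (simp add: mult_exp_exp)
    finally show ?thesis .
  qed
  have "(\<integral>\<^sup>+ z. ennreal ((cmod z)\<^sup>2) \<partial>cnormal) =
      (\<integral>\<^sup>+ z. ennreal ((cmod z)\<^sup>2 * exp (- (cmod z)\<^sup>2)) \<partial>dominating)"
    unfolding cnormal_eq_density dominating_def
    by (subst nn_integral_density, simp, simp, subst nn_integral_density)
       (auto intro!: nn_integral_cong simp: ennreal_mult'[symmetric] mult.commute)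
  also have "\<dots> \<le> (\<integral>\<^sup>+ z. 2 * ennreal (exp (- (cmod (z - 0))\<^sup>2 / 2)) \<partial>dominating)"
    using * by (intro nn_integral_mono) (auto simp: ennreal_mult'[symmetric] ennreal_numeral[symmetric] simp del: ennreal_numeral intro!: ennreal_leI)
  also have "\<dots> = 2 * ennreal 2"
    by (subst nn_integral_cmult, simp, subst nn_integral_dominating_gaussian) auto
  also have "\<dots> = 4" by (simp add: ennreal_numeral[symmetric] ennreal_mult'[symmetric] del: ennreal_numeral)
  finally show ?thesis .
qed

section \<open>Change of measure on product spaces\<close>

text \<open>Induction on \<open>I\<close>, exchanging one coordinate at a time. The comparison is a
  domination between integrals and not an identity of measures (\<open>dominating\<close> has
  infinite mass), so it is carried through Fubini for arbitrary nonnegative integrands. It is used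
  with translation by the signal as the transport map.\<close>

lemma nn_integral_PiM_transport_le:
  fixes M M' :: "'i \<Rightarrow> 'a measure"
  assumes "product_sigma_finite M" "product_sigma_finite M'" and "finite I"
    and tr [measurable]: "\<And>i. \<tau> i \<in> M i \<rightarrow>\<^sub>M M' i"
    and le: "\<And>i f. i \<in> I \<Longrightarrow> f \<in> borel_measurable (M' i) \<Longrightarrow> (\<integral>\<^sup>+ z. f (\<tau> i z) \<partial>M i) \<le> (\<integral>\<^sup>+ y. f y \<partial>M' i)"
    and "f \<in> borel_measurable (PiM I M')"
  shows "(\<integral>\<^sup>+ z. f (\<lambda>i\<in>I. \<tau> i (z i)) \<partial>PiM I M) \<le> (\<integral>\<^sup>+ y. f y \<partial>PiM I M')"
  using assms(3,5,6)
proof (induction I arbitrary: f)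
  case empty
  then show ?case by (simp add: PiM_empty nn_integral_count_space_finite restrict_def)
next
  case (insert i I)
  interpret M: product_sigma_finite M by fact
  interpret M': product_sigma_finite M' by fact
  note [measurable] = insert.prems(2)
  have fm: "(\<lambda>z. f (\<lambda>j\<in>insert i I. \<tau> j (z j))) \<in> borel_measurable (PiM (insert i I) M)"
    by measurable
  have upd: "f (\<lambda>j\<in>insert i I. \<tau> j ((x(i := y)) j)) = f ((\<lambda>j\<in>I. \<tau> j (x j))(i := \<tau> i y))" for x y
    using insert.hyps by (intro arg_cong[where f=f]) (auto simp: restrict_def)
  have "(\<integral>\<^sup>+ z. f (\<lambda>j\<in>insert i I. \<tau> j (z j)) \<partial>PiM (insert i I) M) =
      (\<integral>\<^sup>+ x. \<integral>\<^sup>+ y. f (\<lambda>j\<in>insert i I. \<tau> j ((x(i := y)) j)) \<partial>M i \<partial>PiM I M)"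
    using M.product_nn_integral_insert[OF insert.hyps(1,2) fm] .
  also have "\<dots> = (\<integral>\<^sup>+ x. \<integral>\<^sup>+ y. f ((\<lambda>j\<in>I. \<tau> j (x j))(i := \<tau> i y)) \<partial>M i \<partial>PiM I M)"
    by (simp only: upd)
  also have "\<dots> \<le> (\<integral>\<^sup>+ x. \<integral>\<^sup>+ y. f ((\<lambda>j\<in>I. \<tau> j (x j))(i := y)) \<partial>M' i \<partial>PiM I M)"
  proof (rule nn_integral_mono)
    fix x assume x: "x \<in> space (PiM I M)"
    then have "(\<lambda>j\<in>I. \<tau> j (x j)) \<in> space (PiM I M')"
      using measurable_space[OF tr] by (auto simp: space_PiM)
    from measurable_comp[OF measurable_component_update[OF this insert.hyps(2)] insert.prems(2)]
    have "(\<lambda>y. f ((\<lambda>j\<in>I. \<tau> j (x j))(i := y))) \<in> borel_measurable (M' i)" by (simp add: comp_def)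
    then show "(\<integral>\<^sup>+ y. f ((\<lambda>j\<in>I. \<tau> j (x j))(i := \<tau> i y)) \<partial>M i) \<le> (\<integral>\<^sup>+ y. f ((\<lambda>j\<in>I. \<tau> j (x j))(i := y)) \<partial>M' i)"
      using insert.prems(1)[of i "\<lambda>y. f ((\<lambda>j\<in>I. \<tau> j (x j))(i := y))"] by auto
  qed
  also have "\<dots> \<le> (\<integral>\<^sup>+ x. \<integral>\<^sup>+ y. f (x(i := y)) \<partial>M' i \<partial>PiM I M')"
  proof (rule insert.IH)
    interpret sigma_finite_measure "M' i" by (rule M'.sigma_finite_measures)
    show "(\<lambda>x. \<integral>\<^sup>+ y. f (x(i := y)) \<partial>M' i) \<in> borel_measurable (PiM I M')"
      by measurable
  qed (use insert.prems in auto)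
  also have "\<dots> = (\<integral>\<^sup>+ y. f y \<partial>PiM (insert i I) M')"
    by (rule M'.product_nn_integral_insert[OF insert.hyps(1,2) insert.prems(2), symmetric])
  finally show ?case .
qed

text \<open>Models partial knowledge of the library. \<open>erase {..<K} F\<close> holds the
  unrequested files, which the guessing receiver gets for free; \<open>erase {l..<K} F\<close> is
  what it knows after decoding the first \<open>l\<close> files. The filler 0 is not a file
  value.\<close>

definition erase :: "nat set \<Rightarrow> (nat \<Rightarrow> nat) \<Rightarrow> nat \<Rightarrow> nat" where
  "erase A F = (\<lambda>n. if n \<in> A then 0 else F n)"

text \<open>Here \<open>u\<close> stands for the decoded files at a fixed observation. A tuple
  agreeing with all of \<open>u\<close> is recovered from \<open>erase {l..<K} F\<close>, so no pair
  is hit twice and the sum may be extended to all pairs. This cuts the link between files and cached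
  contents, which can then be summed separately, and keeps only the condition on the users
  \<open>k < l\<close>, whose observations are integrated last.\<close>

lemma sum_consistent_le:
  fixes W :: "'s \<Rightarrow> ennreal"
  assumes "finite \<Omega>" "l \<le> K"
  shows "(\<Sum>F\<in>\<Omega>. if \<forall>k<K. u k = F k then W (s F) * B (erase {l..<K} F) (s F) else 0)
    \<le> (\<Sum>\<rho>\<in>erase {l..<K} ` \<Omega>. \<Sum>\<sigma>\<in>s ` \<Omega>. if \<forall>k<l. u k = \<rho> k then W \<sigma> * B \<rho> \<sigma> else 0)"
proof -
  let ?\<Omega> = "{F \<in> \<Omega>. \<forall>k<K. u k = F k}"
  let ?g = "\<lambda>(\<rho>, \<sigma>). if \<forall>k<l. u k = \<rho> k then W \<sigma> * B \<rho> \<sigma> else 0"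
  have inj: "inj_on (\<lambda>F. (erase {l..<K} F, s F)) ?\<Omega>"
  proof (rule inj_onI)
    fix F G assume FG: "F \<in> ?\<Omega>" "G \<in> ?\<Omega>" "(erase {l..<K} F, s F) = (erase {l..<K} G, s G)"
    show "F = G"
    proof
      fix n show "F n = G n"
      proof (cases "n < K")
        case False
        from FG have "erase {l..<K} F n = erase {l..<K} G n" by simp
        with False show ?thesis by (simp add: erase_def)
      qed (use FG in auto)
    qed
  qed
  have "(\<Sum>F\<in>\<Omega>. if \<forall>k<K. u k = F k then W (s F) * B (erase {l..<K} F) (s F) else 0) =
      (\<Sum>F\<in>?\<Omega>. ?g (erase {l..<K} F, s F))"
    using assms by (intro sum.mono_neutral_cong_right) (auto simp: erase_def)
  also have "\<dots> = (\<Sum>p\<in>(\<lambda>F. (erase {l..<K} F, s F)) ` ?\<Omega>. ?g p)"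
    using inj by (simp add: sum.reindex)
  also have "\<dots> \<le> (\<Sum>p\<in>erase {l..<K} ` \<Omega> \<times> s ` \<Omega>. ?g p)"
    using assms by (intro sum_mono2) auto
  finally show ?thesis by (simp add: sum.cartesian_product)
qed

text \<open>With the first \<open>l\<close> files prescribed by \<open>u\<close> and the others
  below \<open>K\<close> erased, only the unrequested files are free. This count is the source of
  the success probability 2^(- K L): at most 2^(L (N - K)) tuples survive out of 2^(L N).\<close>

lemma card_consistent_le:
  assumes "finite \<Omega>" "l \<le> K"
  shows "card {\<rho> \<in> erase {l..<K} ` \<Omega>. \<forall>k<l. u k = \<rho> k} \<le> card (erase {..<K} ` \<Omega>)"
proof (rule card_inj_on_le[where f = "erase {..<K}"])
  show "inj_on (erase {..<K}) {\<rho> \<in> erase {l..<K} ` \<Omega>. \<forall>k<l. u k = \<rho> k}"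
  proof (rule inj_onI, rule ext)
    fix F G n assume "F \<in> {\<rho> \<in> erase {l..<K} ` \<Omega>. \<forall>k<l. u k = \<rho> k}"
      "G \<in> {\<rho> \<in> erase {l..<K} ` \<Omega>. \<forall>k<l. u k = \<rho> k}" "erase {..<K} F = erase {..<K} G"
    note FG = this
    from FG(3) have "erase {..<K} F n = erase {..<K} G n" by simp
    with FG(1,2) show "F n = G n"
      by (cases "n < l"; cases "n < K") (auto simp: erase_def)
  qed
  have "erase {..<K} (erase {l..<K} F) = erase {..<K} F" for F
    by (auto simp: erase_def)
  then show "erase {..<K} ` {\<rho> \<in> erase {l..<K} ` \<Omega>. \<forall>k<l. u k = \<rho> k} \<subseteq> erase {..<K} ` \<Omega>"
    by auto
qed (use assms in auto)

lemma product_sigma_finite_dominating: "product_sigma_finite (\<lambda>_. dominating)"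
  by (simp add: product_sigma_finite_def sigma_finite_dominating)

lemma product_sigma_finite_cnormal: "product_sigma_finite (\<lambda>_. cnormal)"
  by (simp add: product_sigma_finite_def prob_space_imp_sigma_finite prob_space_cnormal)

lemma nn_integral_noise_translate_le:
  assumes "f \<in> borel_measurable (PiM ({..<K} \<times> {..<T}) (\<lambda>_. borel))"
  shows "(\<integral>\<^sup>+ z. f (\<lambda>i\<in>{..<K} \<times> {..<T}. x i + z i) \<partial>noise_measure K T) \<le>
    (\<integral>\<^sup>+ y. f y \<partial>PiM ({..<K} \<times> {..<T}) (\<lambda>_. dominating))"
  unfolding noise_measure_def
proof (rule nn_integral_PiM_transport_le[OF product_sigma_finite_cnormal product_sigma_finite_dominating])
  show "f \<in> borel_measurable (PiM ({..<K} \<times> {..<T}) (\<lambda>_. dominating))"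
    using assms by (subst measurable_cong_sets[OF sets_PiM_cong refl]) auto
qed (auto intro: nn_integral_cnormal_translate_le)

lemma nn_integral_dominating_gaussian_prod:
  assumes "finite I" "s > 0"
  shows "(\<integral>\<^sup>+ y. (\<Prod>i\<in>I. ennreal (exp (- (cmod (y i - c i))\<^sup>2 / s) / s)) \<partial>PiM I (\<lambda>_. dominating)) = 1"
proof -
  interpret product_sigma_finite "\<lambda>_. dominating" by (rule product_sigma_finite_dominating)
  have "(\<integral>\<^sup>+ y. ennreal (exp (- (cmod (y - c))\<^sup>2 / s) / s) \<partial>dominating) = 1" for c
  proof -
    have "(\<integral>\<^sup>+ y. ennreal (exp (- (cmod (y - c))\<^sup>2 / s) / s) \<partial>dominating) =
        (\<integral>\<^sup>+ y. ennreal (1 / s) * ennreal (exp (- (cmod (y - c))\<^sup>2 / s)) \<partial>dominating)"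
      using assms by (intro nn_integral_cong) (simp add: ennreal_mult'[symmetric])
    also have "\<dots> = ennreal (1 / s) * ennreal s"
      by (subst nn_integral_cmult) (simp_all only: nn_integral_dominating_gaussian[OF assms(2)], simp)
    also have "\<dots> = 1"
      using assms by (simp add: ennreal_mult'[symmetric] del: ennreal_mult_divide_eq)
    finally show ?thesis .
  qed
  with assms show ?thesis
    by (subst product_nn_integral_prod[where f = "\<lambda>i y. ennreal (exp (- (cmod (y - c i))\<^sup>2 / s) / s)"]) auto
qed

text \<open>The success bound for the guessing receiver, summed over file tuples instead of
  averaged. The integrand is the density of its guesses relative to \<open>dominating\<close>,
  restricted to correct decoding. The centre of a late observation may depend on \<open>F\<close>
  only through \<open>erase {l..<K} F\<close> and \<open>s F\<close>, that is, through data the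
  receiver already holds. Integrating the late observations, summing over the guessed contents and
  integrating the early observations each contribute at most a factor 1, so only the count of file
  tuples remains.\<close>

lemma decoding_weight_le:
  fixes \<Omega> :: "(nat \<Rightarrow> nat) set" and w :: "'s \<Rightarrow> real"
    and e :: "(nat \<Rightarrow> nat) \<Rightarrow> 's \<Rightarrow> nat \<times> nat \<Rightarrow> complex"
  assumes \<Omega>: "finite \<Omega>" and l: "l \<le> K" and P: "P > 0"
    and w: "\<And>\<sigma>. w \<sigma> \<ge> 0" "(\<Sum>\<sigma>\<in>s ` \<Omega>. w \<sigma>) \<le> 1"
    and dc [measurable]: "\<And>k. k < K \<Longrightarrow> dc k \<in> measurable (PiM {..<T} (\<lambda>_. borel)) (count_space UNIV)"
  shows "(\<Sum>F\<in>\<Omega>. \<integral>\<^sup>+ z. indicator {z. \<forall>k<K. dc k (\<lambda>t\<in>{..<T}. x F (k, t) + z (k, t)) = F k} z *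
      (ennreal (w (s F)) *
       (\<Prod>i\<in>{..<l} \<times> {..<T}. ennreal (exp (- (cmod (x F i + z i - c i))\<^sup>2 / P) / P)) *
       (\<Prod>i\<in>{l..<K} \<times> {..<T}. ennreal (exp (- (cmod (x F i + z i -
          ((\<Sum>j<l. C (fst i) j * (x F (j, snd i) + z (j, snd i))) + e (erase {l..<K} F) (s F) i)))\<^sup>2))))
      \<partial>noise_measure K T) \<le> of_nat (card (erase {..<K} ` \<Omega>))"
proof -
  interpret product_sigma_finite "\<lambda>_ :: nat \<times> nat. dominating" by (rule product_sigma_finite_dominating)
  define I1 where "I1 = {..<l} \<times> {..<T}"
  define I2 where "I2 = {l..<K} \<times> {..<T}"
  have I: "{..<K} \<times> {..<T} = I1 \<union> I2" "I1 \<inter> I2 = {}" "finite I1" "finite I2"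
    using l by (auto simp: I1_def I2_def)
  define A where "A = (\<lambda>y. \<Prod>i\<in>I1. ennreal (exp (- (cmod (y i - c i))\<^sup>2 / P) / P))"
  define h where "h = (\<lambda>\<rho> \<sigma> (y :: nat \<times> nat \<Rightarrow> complex) i. (\<Sum>j<l. C (fst i) j * y (j, snd i)) + e \<rho> \<sigma> i)"
  define B where "B = (\<lambda>\<rho> \<sigma> y. \<Prod>i\<in>I2. ennreal (exp (- (cmod (y i - h \<rho> \<sigma> y i))\<^sup>2)))"
  define u where "u = (\<lambda>y k. dc k (\<lambda>t\<in>{..<T}. y (k, t)))"
  define \<phi> where "\<phi> = (\<lambda>F y. indicator {y. \<forall>k<K. u y k = F k} y * (ennreal (w (s F)) * A y * B (erase {l..<K} F) (s F) y))"
  have um [measurable]: "(\<lambda>y. u y k) \<in> measurable (PiM J (\<lambda>_. borel)) (count_space UNIV)"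
    if "k < K" "{k} \<times> {..<T} \<subseteq> J" for k J
  proof -
    have "(\<lambda>y. \<lambda>t\<in>{..<T}. y (k, t)) \<in> measurable (PiM J (\<lambda>_. borel)) (PiM {..<T} (\<lambda>_. borel :: complex measure))"
      using that by (intro measurable_restrict) (auto intro!: measurable_component_singleton)
    from measurable_comp[OF this dc[OF \<open>k < K\<close>]] show ?thesis
      by (simp add: u_def comp_def)
  qed
  have cm [measurable]: "(\<lambda>y. y i) \<in> borel_measurable (PiM J (\<lambda>_. borel :: complex measure))" if "i \<in> J" for i and J :: "(nat \<times> nat) set"
    using that by measurable
  have Am [measurable]: "A \<in> borel_measurable (PiM J (\<lambda>_. borel))" if "I1 \<subseteq> J" for J
    unfolding A_def by measurable (use that in auto)
  have hm: "(\<lambda>y. h \<rho> \<sigma> y i) \<in> borel_measurable (PiM (I1 \<union> I2) (\<lambda>_. borel))" if "i \<in> I2" for \<rho> \<sigma> i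
    unfolding h_def by measurable (use that in \<open>auto simp: I1_def I2_def\<close>)

  have Bm [measurable]: "B \<rho> \<sigma> \<in> borel_measurable (PiM (I1 \<union> I2) (\<lambda>_. borel))" for \<rho> \<sigma>
    unfolding B_def using hm by measurable
  have ind: "indicator {y. \<forall>k<K. u y k = F k} y = (\<Prod>k<K. indicator {F k} (u y k) :: ennreal)" for F y
  proof (cases "\<forall>k<K. u y k = F k")
    case False
    then obtain k where k: "k \<in> {..<K}" "u y k \<noteq> F k" by auto
    then have "(\<Prod>k<K. indicator {F k} (u y k) :: ennreal) = 0"
      by (intro prod_zero bexI[of _ k]) simp_all
    with k show ?thesis by (auto simp: indicator_def)
  qed simp
  have \<phi>m: "\<phi> F \<in> borel_measurable (PiM (I1 \<union> I2) (\<lambda>_. borel))" for F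
  proof -
    have "(\<lambda>y. indicator {F k} (u y k) :: ennreal) \<in> borel_measurable (PiM (I1 \<union> I2) (\<lambda>_. borel))"
      if "k \<in> {..<K}" for k
    proof (rule measurable_compose[where f = "\<lambda>y. u y k" and g = "indicator {F k}" and N = "count_space UNIV"])
      show "(\<lambda>y. u y k) \<in> measurable (PiM (I1 \<union> I2) (\<lambda>_. borel)) (count_space UNIV)"
        using that l by (intro um) (auto simp: I1_def I2_def)
    qed simp
    then show ?thesis
      unfolding \<phi>_def ind
      by (intro borel_measurable_times_ennreal borel_measurable_prod_ennreal borel_measurable_const Am Bm) simp_all
  qed
  have step: "(\<integral>\<^sup>+ z. indicator {z. \<forall>k<K. dc k (\<lambda>t\<in>{..<T}. x F (k, t) + z (k, t)) = F k} z *
      (ennreal (w (s F)) *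
       (\<Prod>i\<in>{..<l} \<times> {..<T}. ennreal (exp (- (cmod (x F i + z i - c i))\<^sup>2 / P) / P)) *
       (\<Prod>i\<in>{l..<K} \<times> {..<T}. ennreal (exp (- (cmod (x F i + z i -
          ((\<Sum>j<l. C (fst i) j * (x F (j, snd i) + z (j, snd i))) + e (erase {l..<K} F) (s F) i)))\<^sup>2))))
      \<partial>noise_measure K T) \<le> (\<integral>\<^sup>+ y. \<phi> F y \<partial>PiM (I1 \<union> I2) (\<lambda>_. dominating))" (is "?L F \<le> ?R F") for F
  proof -
    have "?L F = (\<integral>\<^sup>+ z. \<phi> F (\<lambda>i\<in>{..<K} \<times> {..<T}. x F i + z i) \<partial>noise_measure K T)"
    proof (rule nn_integral_cong)
      fix z
      let ?y = "\<lambda>i\<in>{..<K} \<times> {..<T}. x F i + z i"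
      have "u ?y k = dc k (\<lambda>t\<in>{..<T}. x F (k, t) + z (k, t))" if "k < K" for k
        unfolding u_def using that by (intro arg_cong[where f = "dc k"]) (auto simp: restrict_def)
      moreover have "A ?y = (\<Prod>i\<in>I1. ennreal (exp (- (cmod (x F i + z i - c i))\<^sup>2 / P) / P))"
        unfolding A_def using l by (intro prod.cong) (auto simp: I1_def)
      moreover have "B (erase {l..<K} F) (s F) ?y = (\<Prod>i\<in>I2. ennreal (exp (- (cmod (x F i + z i -
          ((\<Sum>j<l. C (fst i) j * (x F (j, snd i) + z (j, snd i))) + e (erase {l..<K} F) (s F) i)))\<^sup>2)))"
        unfolding B_def h_def using l by (intro prod.cong) (auto simp: I2_def)
      ultimately show "indicator {z. \<forall>k<K. dc k (\<lambda>t\<in>{..<T}. x F (k, t) + z (k, t)) = F k} z *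
        (ennreal (w (s F)) *
         (\<Prod>i\<in>{..<l} \<times> {..<T}. ennreal (exp (- (cmod (x F i + z i - c i))\<^sup>2 / P) / P)) *
         (\<Prod>i\<in>{l..<K} \<times> {..<T}. ennreal (exp (- (cmod (x F i + z i -
            ((\<Sum>j<l. C (fst i) j * (x F (j, snd i) + z (j, snd i))) + e (erase {l..<K} F) (s F) i)))\<^sup>2)))) = \<phi> F ?y"
        unfolding \<phi>_def I1_def[symmetric] I2_def[symmetric] by (simp add: indicator_def)
    qed
    also have "\<dots> \<le> ?R F"
      using nn_integral_noise_translate_le[of "\<phi> F" K T "x F"] \<phi>m unfolding I by auto
    finally show ?thesis .
  qed
  \<comment> \<open>The late guesses have unit variance. The divisions by 1 are written out so that
    the normalisation of Gaussian products applies with \<open>s\<close> = 1.\<close>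
  have point: "(\<Sum>F\<in>\<Omega>. \<phi> F (merge I1 I2 (y1, y2))) \<le>
      (\<Sum>\<rho>\<in>erase {l..<K} ` \<Omega>. \<Sum>\<sigma>\<in>s ` \<Omega>. (if \<forall>k<l. u y1 k = \<rho> k then ennreal (w \<sigma>) * A y1 else 0) *
        (\<Prod>i\<in>I2. ennreal (exp (- (cmod (y2 i - h \<rho> \<sigma> y1 i))\<^sup>2 / 1) / 1)))" for y1 y2
  proof -
    let ?y = "merge I1 I2 (y1, y2)"
    have u1: "u ?y k = u y1 k" if "k < l" for k
      unfolding u_def using that by (intro arg_cong[where f = "dc k"]) (auto simp: restrict_def I1_def merge_def)
    have A1: "A ?y = A y1"
      unfolding A_def by (intro prod.cong) (auto simp: merge_def)
    have B1: "B \<rho> \<sigma> ?y = (\<Prod>i\<in>I2. ennreal (exp (- (cmod (y2 i - h \<rho> \<sigma> y1 i))\<^sup>2 / 1) / 1))" for \<rho> \<sigma>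
      unfolding B_def h_def by (intro prod.cong) (auto simp: I1_def I2_def merge_def)
    have "(\<Sum>F\<in>\<Omega>. \<phi> F ?y) =
        (\<Sum>F\<in>\<Omega>. if \<forall>k<K. u ?y k = F k then (\<lambda>\<sigma>. ennreal (w \<sigma>) * A ?y) (s F) * B (erase {l..<K} F) (s F) ?y else 0)"
      by (intro sum.cong) (auto simp: \<phi>_def indicator_def)
    also have "\<dots> \<le> (\<Sum>\<rho>\<in>erase {l..<K} ` \<Omega>. \<Sum>\<sigma>\<in>s ` \<Omega>.
        if \<forall>k<l. u ?y k = \<rho> k then (ennreal (w \<sigma>) * A ?y) * B \<rho> \<sigma> ?y else 0)"
      by (rule sum_consistent_le[OF \<Omega> l])
    also have "\<dots> = (\<Sum>\<rho>\<in>erase {l..<K} ` \<Omega>. \<Sum>\<sigma>\<in>s ` \<Omega>. (if \<forall>k<l. u y1 k = \<rho> k then ennreal (w \<sigma>) * A y1 else 0) *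
        (\<Prod>i\<in>I2. ennreal (exp (- (cmod (y2 i - h \<rho> \<sigma> y1 i))\<^sup>2 / 1) / 1)))"
      unfolding A1 B1 using u1 by (intro sum.cong refl) auto
    finally show ?thesis .
  qed
  \<comment> \<open>The centres \<open>h\<close> read only coordinates in \<open>I1\<close>. With
    \<open>y1\<close> fixed, the late factors are therefore genuine Gaussian densities in
    \<open>y2\<close>, even though their centres vary with the early observations.\<close>
  have inner: "(\<integral>\<^sup>+ y2. (\<Sum>F\<in>\<Omega>. \<phi> F (merge I1 I2 (y1, y2))) \<partial>PiM I2 (\<lambda>_. dominating)) \<le>
      of_nat (card (erase {..<K} ` \<Omega>)) * A y1" for y1
  proof -
    let ?S = "{\<rho> \<in> erase {l..<K} ` \<Omega>. \<forall>k<l. u y1 k = \<rho> k}"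
    have "(\<integral>\<^sup>+ y2. (\<Sum>F\<in>\<Omega>. \<phi> F (merge I1 I2 (y1, y2))) \<partial>PiM I2 (\<lambda>_. dominating)) \<le>
       (\<integral>\<^sup>+ y2. (\<Sum>\<rho>\<in>erase {l..<K} ` \<Omega>. \<Sum>\<sigma>\<in>s ` \<Omega>. (if \<forall>k<l. u y1 k = \<rho> k then ennreal (w \<sigma>) * A y1 else 0) *
        (\<Prod>i\<in>I2. ennreal (exp (- (cmod (y2 i - h \<rho> \<sigma> y1 i))\<^sup>2 / 1) / 1))) \<partial>PiM I2 (\<lambda>_. dominating))"
      by (intro nn_integral_mono point)
    also have "\<dots> = (\<Sum>\<rho>\<in>erase {l..<K} ` \<Omega>. \<Sum>\<sigma>\<in>s ` \<Omega>. (if \<forall>k<l. u y1 k = \<rho> k then ennreal (w \<sigma>) * A y1 else 0) *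
        (\<integral>\<^sup>+ y2. (\<Prod>i\<in>I2. ennreal (exp (- (cmod (y2 i - h \<rho> \<sigma> y1 i))\<^sup>2 / 1) / 1)) \<partial>PiM I2 (\<lambda>_. dominating)))"
    proof -
      have [measurable]: "(\<lambda>y2. \<Prod>i\<in>I2. ennreal (exp (- (cmod (y2 i - d i))\<^sup>2 / 1) / 1)) \<in>
          borel_measurable (PiM I2 (\<lambda>_. dominating))" for d by measurable
      show ?thesis
        by (subst nn_integral_sum, measurable, intro sum.cong refl, subst nn_integral_sum, measurable,
            intro sum.cong refl nn_integral_cmult, measurable)
    qed
    also have "\<dots> = (\<Sum>\<rho>\<in>erase {l..<K} ` \<Omega>. \<Sum>\<sigma>\<in>s ` \<Omega>. if \<forall>k<l. u y1 k = \<rho> k then ennreal (w \<sigma>) * A y1 else 0)"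
      using I(4) by (subst nn_integral_dominating_gaussian_prod) auto
    also have "\<dots> = (\<Sum>\<rho>\<in>?S. \<Sum>\<sigma>\<in>s ` \<Omega>. ennreal (w \<sigma>) * A y1)"
      using \<Omega> by (intro sum.mono_neutral_cong_right) auto
    also have "\<dots> = of_nat (card ?S) * (ennreal (\<Sum>\<sigma>\<in>s ` \<Omega>. w \<sigma>) * A y1)"
      using w(1) by (simp add: sum_distrib_right[symmetric])
    also have "\<dots> \<le> of_nat (card (erase {..<K} ` \<Omega>)) * (1 * A y1)"
      using card_consistent_le[OF \<Omega> l, of "u y1"] w(2)
      by (intro mult_mono mult_right_mono of_nat_mono) (auto simp: ennreal_le_1)
    finally show ?thesis by simp
  qed
  have dom: "borel_measurable (PiM J (\<lambda>_. dominating)) = borel_measurable (PiM J (\<lambda>_. borel :: complex measure))" for J :: "(nat \<times> nat) set"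
    by (rule measurable_cong_sets, rule sets_PiM_cong, simp_all)
  have \<phi>m': "\<phi> F \<in> borel_measurable (PiM (I1 \<union> I2) (\<lambda>_. dominating))" for F
    unfolding dom by (rule \<phi>m)
  have Am': "A \<in> borel_measurable (PiM I1 (\<lambda>_. dominating))"
    unfolding dom by (rule Am) simp
  have "(\<Sum>F\<in>\<Omega>. ?L F) \<le> (\<Sum>F\<in>\<Omega>. ?R F)"
    by (intro sum_mono step)
  also have "\<dots> = (\<integral>\<^sup>+ y. (\<Sum>F\<in>\<Omega>. \<phi> F y) \<partial>PiM (I1 \<union> I2) (\<lambda>_. dominating))"
    by (rule nn_integral_sum[symmetric]) (rule \<phi>m')
  also have "\<dots> = (\<integral>\<^sup>+ y1. \<integral>\<^sup>+ y2. (\<Sum>F\<in>\<Omega>. \<phi> F (merge I1 I2 (y1, y2))) \<partial>PiM I2 (\<lambda>_. dominating) \<partial>PiM I1 (\<lambda>_. dominating))"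
    by (intro product_nn_integral_fold I borel_measurable_sum \<phi>m')
  also have "\<dots> \<le> (\<integral>\<^sup>+ y1. of_nat (card (erase {..<K} ` \<Omega>)) * A y1 \<partial>PiM I1 (\<lambda>_. dominating))"
    by (intro nn_integral_mono inner)
  also have "\<dots> = of_nat (card (erase {..<K} ` \<Omega>)) * (\<integral>\<^sup>+ y1. A y1 \<partial>PiM I1 (\<lambda>_. dominating))"
    by (intro nn_integral_cmult Am')
  also have "\<dots> = of_nat (card (erase {..<K} ` \<Omega>))"
    unfolding A_def using I(3) P by (subst nn_integral_dominating_gaussian_prod) auto
  finally show ?thesis .
qed

section \<open>One-shot converse\<close>

lemma nn_integral_noise_component_le:
  assumes "k < K" "t < T"
  shows "(\<integral>\<^sup>+ z. ennreal ((cmod (z (k, t)))\<^sup>2) \<partial>noise_measure K T) \<le> 4"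
proof -
  have "distr (noise_measure K T) cnormal (\<lambda>z. z (k, t)) = cnormal"
    unfolding noise_measure_def using assms by (intro distr_PiM_component prob_space_cnormal) auto
  then have "(\<integral>\<^sup>+ z. ennreal ((cmod z)\<^sup>2) \<partial>cnormal) =
      (\<integral>\<^sup>+ z. ennreal ((cmod z)\<^sup>2) \<partial>distr (noise_measure K T) cnormal (\<lambda>z. z (k, t)))"
    by simp
  also have "\<dots> = (\<integral>\<^sup>+ z. ennreal ((cmod (z (k, t)))\<^sup>2) \<partial>noise_measure K T)"
    unfolding noise_measure_def using assms
    by (subst nn_integral_distr) (auto intro!: measurable_component_singleton)
  finally show ?thesis using nn_integral_cnormal_square_le by simp
qed

lemma measurable_noise_component:
  assumes "i \<in> {..<K} \<times> {..<T}"
  shows "(\<lambda>z. z i) \<in> borel_measurable (noise_measure K T)"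
  unfolding noise_measure_def using measurable_component_singleton[OF assms, of "\<lambda>_. cnormal"]
  by (simp add: measurable_cong_sets[OF refl sets_cnormal])

lemma prob_space_noise: "prob_space (noise_measure K T)"
  unfolding noise_measure_def by (intro prob_space_PiM prob_space_cnormal)

lemma cmod_add_square_le: "(cmod (a + b))\<^sup>2 \<le> 2 * (cmod a)\<^sup>2 + 2 * (cmod b)\<^sup>2"
proof -
  have "(cmod (a + b))\<^sup>2 \<le> (cmod a + cmod b)\<^sup>2"
    by (intro power_mono norm_triangle_ineq) auto
  also have "\<dots> \<le> 2 * (cmod a)\<^sup>2 + 2 * (cmod b)\<^sup>2"
    using zero_le_power2[of "cmod a - cmod b"] by (simp add: power2_eq_square algebra_simps)
  finally show ?thesis .
qed

lemma cmod_sum_square_le: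
  assumes "finite A"
  shows "(cmod (\<Sum>i\<in>A. f i))\<^sup>2 \<le> real (card A) * (\<Sum>i\<in>A. (cmod (f i))\<^sup>2)"
proof -
  have "(cmod (\<Sum>i\<in>A. f i))\<^sup>2 \<le> (\<Sum>i\<in>A. cmod (f i))\<^sup>2"
    by (intro power_mono norm_sum) auto
  also have "\<dots> \<le> (\<Sum>i\<in>A. (cmod (f i))\<^sup>2) * card A"
    by (rule sum_squared_le_sum_of_squares)
  finally show ?thesis by (simp add: mult.commute)
qed

lemma nn_integral_noise_shift_le:
  assumes "k < K" "t < T"
  shows "(\<integral>\<^sup>+ z. ennreal ((cmod (a + z (k, t)))\<^sup>2) \<partial>noise_measure K T) \<le> ennreal (2 * (cmod a)\<^sup>2 + 8)"
proof -
  interpret prob_space "noise_measure K T" by (rule prob_space_noise)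
  have [measurable]: "(\<lambda>z. z (k, t)) \<in> borel_measurable (noise_measure K T)"
    using assms by (intro measurable_noise_component) auto
  have "(\<integral>\<^sup>+ z. ennreal ((cmod (a + z (k, t)))\<^sup>2) \<partial>noise_measure K T) \<le>
      (\<integral>\<^sup>+ z. ennreal (2 * (cmod a)\<^sup>2) + 2 * ennreal ((cmod (z (k, t)))\<^sup>2) \<partial>noise_measure K T)"
    using cmod_add_square_le
    by (intro nn_integral_mono)
      (simp add: ennreal_mult'[symmetric] ennreal_plus[symmetric] ennreal_numeral[symmetric] del: ennreal_numeral ennreal_plus)
  also have "\<dots> = ennreal (2 * (cmod a)\<^sup>2) + 2 * (\<integral>\<^sup>+ z. ennreal ((cmod (z (k, t)))\<^sup>2) \<partial>noise_measure K T)"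
    by (simp add: nn_integral_add nn_integral_cmult emeasure_space_1)
  also have "\<dots> \<le> ennreal (2 * (cmod a)\<^sup>2) + 2 * 4"
    by (intro add_left_mono mult_left_mono nn_integral_noise_component_le assms) auto
  also have "\<dots> = ennreal (2 * (cmod a)\<^sup>2 + 8)"
    by (simp add: ennreal_plus)
  finally show ?thesis .
qed

text \<open>This is the noise left when the signal of user \<open>k\<close> is predicted from the
  observations of the first \<open>l\<close> users. Splitting off the noise of user \<open>k\<close>
  costs a factor 2 and Cauchy-Schwarz over the \<open>l\<close> terms a factor \<open>l\<close>;
  each second moment is at most 4. The result does not involve the power, so late users do not
  contribute to the coefficient of log P.\<close>

lemma nn_integral_noise_combination_le:
  assumes "k < K" "t < T" "l \<le> K"
  shows "(\<integral>\<^sup>+ z. ennreal ((cmod (z (k, t) - (\<Sum>j<l. b j * z (j, t))))\<^sup>2) \<partial>noise_measure K T)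
    \<le> ennreal (8 + 8 * real l * (\<Sum>j<l. (cmod (b j))\<^sup>2))"
proof -
  have [measurable]: "(\<lambda>z. z (k, t)) \<in> borel_measurable (noise_measure K T)" if "k < K" for k
    using assms that by (intro measurable_noise_component) auto
  have pt: "(cmod (z (k, t) - (\<Sum>j<l. b j * z (j, t))))\<^sup>2 \<le>
      2 * (cmod (z (k, t)))\<^sup>2 + (\<Sum>j<l. (2 * real l * (cmod (b j))\<^sup>2) * (cmod (z (j, t)))\<^sup>2)" for z :: "nat \<times> nat \<Rightarrow> complex"
  proof -
    have "(cmod (z (k, t) - (\<Sum>j<l. b j * z (j, t))))\<^sup>2 \<le>
        2 * (cmod (z (k, t)))\<^sup>2 + 2 * (cmod (\<Sum>j<l. b j * z (j, t)))\<^sup>2"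
      using cmod_add_square_le[of "z (k, t)" "- (\<Sum>j<l. b j * z (j, t))"] by simp
    also have "(cmod (\<Sum>j<l. b j * z (j, t)))\<^sup>2 \<le> real l * (\<Sum>j<l. (cmod (b j * z (j, t)))\<^sup>2)"
      using cmod_sum_square_le[of "{..<l}"] by simp
    also have "2 * (real l * (\<Sum>j<l. (cmod (b j * z (j, t)))\<^sup>2)) =
        (\<Sum>j<l. (2 * real l * (cmod (b j))\<^sup>2) * (cmod (z (j, t)))\<^sup>2)"
      by (simp add: sum_distrib_left norm_mult power_mult_distrib mult.assoc)
    finally show ?thesis by simp
  qed
  have "(\<integral>\<^sup>+ z. ennreal ((cmod (z (k, t) - (\<Sum>j<l. b j * z (j, t))))\<^sup>2) \<partial>noise_measure K T) \<le>
      (\<integral>\<^sup>+ z. ennreal 2 * ennreal ((cmod (z (k, t)))\<^sup>2) +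
        (\<Sum>j<l. ennreal (2 * real l * (cmod (b j))\<^sup>2) * ennreal ((cmod (z (j, t)))\<^sup>2)) \<partial>noise_measure K T)"
  proof (rule nn_integral_mono)
    fix z :: "nat \<times> nat \<Rightarrow> complex"
    have "ennreal 2 * ennreal ((cmod (z (k, t)))\<^sup>2) +
        (\<Sum>j<l. ennreal (2 * real l * (cmod (b j))\<^sup>2) * ennreal ((cmod (z (j, t)))\<^sup>2)) =
        ennreal (2 * (cmod (z (k, t)))\<^sup>2 + (\<Sum>j<l. (2 * real l * (cmod (b j))\<^sup>2) * (cmod (z (j, t)))\<^sup>2))"
      by (simp add: ennreal_mult'[symmetric] sum_nonneg ennreal_plus del: ennreal_numeral)
    then show "ennreal ((cmod (z (k, t) - (\<Sum>j<l. b j * z (j, t))))\<^sup>2) \<le> ennreal 2 * ennreal ((cmod (z (k, t)))\<^sup>2) +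
        (\<Sum>j<l. ennreal (2 * real l * (cmod (b j))\<^sup>2) * ennreal ((cmod (z (j, t)))\<^sup>2))"
      using pt[of z] by (simp only: ennreal_leI)
  qed
  also have "\<dots> = ennreal 2 * (\<integral>\<^sup>+ z. ennreal ((cmod (z (k, t)))\<^sup>2) \<partial>noise_measure K T) +
        (\<Sum>j<l. ennreal (2 * real l * (cmod (b j))\<^sup>2) * (\<integral>\<^sup>+ z. ennreal ((cmod (z (j, t)))\<^sup>2) \<partial>noise_measure K T))"
  proof -
    have [measurable]: "(\<lambda>z. z (j, t)) \<in> borel_measurable (noise_measure K T)" if "j \<in> {..<l}" for j
      using assms that by simp
    have m1: "(\<lambda>z. ennreal ((cmod (z (k, t)))\<^sup>2)) \<in> borel_measurable (noise_measure K T)"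
      using assms by simp
    have m2: "(\<lambda>z. \<Sum>j<l. ennreal (2 * real l * (cmod (b j))\<^sup>2) * ennreal ((cmod (z (j, t)))\<^sup>2))
        \<in> borel_measurable (noise_measure K T)"
      by measurable
    have "(\<integral>\<^sup>+ z. (\<Sum>j<l. ennreal (2 * real l * (cmod (b j))\<^sup>2) * ennreal ((cmod (z (j, t)))\<^sup>2)) \<partial>noise_measure K T) =
        (\<Sum>j<l. \<integral>\<^sup>+ z. ennreal (2 * real l * (cmod (b j))\<^sup>2) * ennreal ((cmod (z (j, t)))\<^sup>2) \<partial>noise_measure K T)"
      by (rule nn_integral_sum) measurable
    also have "\<dots> = (\<Sum>j<l. ennreal (2 * real l * (cmod (b j))\<^sup>2) * (\<integral>\<^sup>+ z. ennreal ((cmod (z (j, t)))\<^sup>2) \<partial>noise_measure K T))"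
      by (intro sum.cong refl nn_integral_cmult) measurable
    finally show ?thesis
      using m1 m2 by (simp only: nn_integral_add nn_integral_cmult borel_measurable_times_ennreal borel_measurable_const)
  qed
  also have "\<dots> \<le> ennreal 2 * 4 + (\<Sum>j<l. ennreal (2 * real l * (cmod (b j))\<^sup>2) * 4)"
    using assms by (intro add_mono mult_left_mono sum_mono nn_integral_noise_component_le) auto
  also have "\<dots> = ennreal (8 + 8 * real l * (\<Sum>j<l. (cmod (b j))\<^sup>2))"
  proof -
    have "ennreal 2 * 4 + (\<Sum>j<l. ennreal (2 * real l * (cmod (b j))\<^sup>2) * 4) =
        ennreal 2 * ennreal 4 + (\<Sum>j<l. ennreal (2 * real l * (cmod (b j))\<^sup>2) * ennreal 4)"
      by simp
    also have "\<dots> = ennreal (2 * 4 + (\<Sum>j<l. 2 * real l * (cmod (b j))\<^sup>2 * 4))"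
      by (simp add: ennreal_mult'[symmetric] sum_nonneg ennreal_plus del: ennreal_numeral)
    finally show ?thesis by (simp add: sum_distrib_left mult_ac)
  qed
  finally show ?thesis .
qed

lemma one_plus_le_exp_tangent: "1 + a \<le> exp a * exp (- g) + (g :: real)"
  using exp_ge_add_one_self[of "a - g"] by (simp add: exp_diff exp_minus field_simps)

text \<open>The tangent inequality is applied pointwise on correct decoding and integrated.
  \<open>decoding_weight_le\<close> controls its exponential part, and second moments control the
  mean of \<open>g\<close>. The term \<open>2 * (cmod (x F i - c i))\<^sup>2 + 8\<close> bounds the
  second moment of a centred observation, with 8 twice the bound 4 for the noise.\<close>

lemma one_shot_converse:
  fixes \<Omega> :: "(nat \<Rightarrow> nat) set" and w :: "'s \<Rightarrow> real"
    and e :: "(nat \<Rightarrow> nat) \<Rightarrow> 's \<Rightarrow> nat \<times> nat \<Rightarrow> complex"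
  assumes \<Omega>: "finite \<Omega>" and l: "l \<le> K" and P: "P \<ge> 1" and a: "a \<ge> 0"
    and w: "\<And>\<sigma>. w \<sigma> \<ge> 0" "\<And>F. F \<in> \<Omega> \<Longrightarrow> w (s F) > 0" "\<And>F. F \<in> \<Omega> \<Longrightarrow> w (s F) \<le> 1" "(\<Sum>\<sigma>\<in>s ` \<Omega>. w \<sigma>) \<le> 1"
    and dc: "\<And>k. k < K \<Longrightarrow> dc k \<in> measurable (PiM {..<T} (\<lambda>_. borel)) (count_space UNIV)"
    and x: "\<And>F k t. F \<in> \<Omega> \<Longrightarrow> k \<in> {l..<K} \<Longrightarrow> t < T \<Longrightarrow>
      x F (k, t) = (\<Sum>j<l. C k j * x F (j, t)) + e (erase {l..<K} F) (s F) (k, t)"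
  shows "(1 + a) * (\<Sum>F\<in>\<Omega>. measure (noise_measure K T)
      {z \<in> space (noise_measure K T). \<forall>k<K. dc k (\<lambda>t\<in>{..<T}. x F (k, t) + z (k, t)) = F k}) \<le>
    exp a * real (card (erase {..<K} ` \<Omega>)) +
    (\<Sum>F\<in>\<Omega>. ln (1 / w (s F)) + (\<Sum>i\<in>{..<l} \<times> {..<T}. ln P + (2 * (cmod (x F i - c i))\<^sup>2 + 8) / P) +
      real T * (\<Sum>k\<in>{l..<K}. 8 + 8 * real l * (\<Sum>j<l. (cmod (C k j))\<^sup>2)))"
proof -
  let ?N = "noise_measure K T"
  interpret prob_space ?N by (rule prob_space_noise)
  define I1 where "I1 = {..<l} \<times> {..<T}"
  define I2 where "I2 = {l..<K} \<times> {..<T}"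
  have fin [simp]: "finite I1" "finite I2" by (auto simp: I1_def I2_def)
  have zm [measurable]: "(\<lambda>z. z (k, t)) \<in> borel_measurable ?N" if "k < K" "t < T" for k t
    using that by (intro measurable_noise_component) auto
  define G where "G = (\<lambda>F. {z \<in> space ?N. \<forall>k<K. dc k (\<lambda>t\<in>{..<T}. x F (k, t) + z (k, t)) = F k})"
  define d where "d = (\<lambda>i (z :: nat \<times> nat \<Rightarrow> complex). z i - (\<Sum>j<l. C (fst i) j * z (j, snd i)))"
  define g where "g = (\<lambda>F z. ln (1 / w (s F)) + (\<Sum>i\<in>I1. ln P + (cmod (x F i + z i - c i))\<^sup>2 / P) + (\<Sum>i\<in>I2. (cmod (d i z))\<^sup>2))"
  define E where "E = (\<lambda>F z. ennreal (w (s F)) *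
       (\<Prod>i\<in>{..<l} \<times> {..<T}. ennreal (exp (- (cmod (x F i + z i - c i))\<^sup>2 / P) / P)) *
       (\<Prod>i\<in>{l..<K} \<times> {..<T}. ennreal (exp (- (cmod (x F i + z i -
          ((\<Sum>j<l. C (fst i) j * (x F (j, snd i) + z (j, snd i))) + e (erase {l..<K} F) (s F) i)))\<^sup>2))))"
  have Gm [measurable]: "G F \<in> sets ?N" for F
  proof -
    have "(\<lambda>z. dc k (\<lambda>t\<in>{..<T}. x F (k, t) + z (k, t))) \<in> measurable ?N (count_space UNIV)" if "k < K" for k
    proof (rule measurable_compose[where f = "\<lambda>z. \<lambda>t\<in>{..<T}. x F (k, t) + z (k, t)" and g = "dc k", OF _ dc[OF that]])
      show "(\<lambda>z. \<lambda>t\<in>{..<T}. x F (k, t) + z (k, t)) \<in> measurable ?N (PiM {..<T} (\<lambda>_. borel))"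
        using that by (intro measurable_restrict) auto
    qed
    from measurable_sets[OF this, of _ "{F _}"]
    have "{z \<in> space ?N. dc k (\<lambda>t\<in>{..<T}. x F (k, t) + z (k, t)) = F k} \<in> sets ?N" if "k < K" for k
      using that by (simp add: vimage_def Int_def conj_commute)
    then have *: "{z \<in> space ?N. dc k (\<lambda>t\<in>{..<T}. x F (k, t) + z (k, t)) = F k} \<in> sets ?N" if "k \<in> {..<K}" for k
      using that by blast
    have eq: "G F = {z \<in> space ?N. \<forall>k\<in>{..<K}. dc k (\<lambda>t\<in>{..<T}. x F (k, t) + z (k, t)) = F k}"
      by (auto simp: G_def)
    show ?thesis
      unfolding eq by (rule sets.sets_Collect_finite_All[OF *]) (assumption, rule finite_lessThan)
  qed
  have E_eq: "E F z = ennreal (exp (- g F z))" if F: "F \<in> \<Omega>" for F z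
  proof -
    \<comment> \<open>Assumption \<open>x\<close> says that the signal of a late user equals its
      prediction, so subtracting the predicted observation cancels all signal terms and leaves
      \<open>d i z\<close>, which is noise only.\<close>
    have "x F i + z i - ((\<Sum>j<l. C (fst i) j * (x F (j, snd i) + z (j, snd i))) + e (erase {l..<K} F) (s F) i) = d i z"
      if "i \<in> I2" for i
      using x[OF F, of "fst i" "snd i"] that by (auto simp: I2_def d_def sum.distrib distrib_left)
    then have "E F z = ennreal (w (s F)) * (\<Prod>i\<in>I1. ennreal (exp (- (cmod (x F i + z i - c i))\<^sup>2 / P) / P)) *
        (\<Prod>i\<in>I2. ennreal (exp (- (cmod (d i z))\<^sup>2)))"
      unfolding E_def I1_def[symmetric] I2_def[symmetric] by simp
    also have "\<dots> = ennreal (w (s F) * (\<Prod>i\<in>I1. exp (- (cmod (x F i + z i - c i))\<^sup>2 / P) / P) * (\<Prod>i\<in>I2. exp (- (cmod (d i z))\<^sup>2)))"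
      using w(1) P by (simp add: prod_ennreal ennreal_mult prod_nonneg)
    also have "w (s F) * (\<Prod>i\<in>I1. exp (- (cmod (x F i + z i - c i))\<^sup>2 / P) / P) * (\<Prod>i\<in>I2. exp (- (cmod (d i z))\<^sup>2)) = exp (- g F z)"
    proof -
      have ee: "exp (- (ln P + q)) = exp (- q) / P" for q
        using P by (simp add: exp_diff exp_minus field_simps)
      have "(\<Prod>i\<in>I1. exp (- (cmod (x F i + z i - c i))\<^sup>2 / P) / P) =
          exp (- (\<Sum>i\<in>I1. ln P + (cmod (x F i + z i - c i))\<^sup>2 / P))"
        unfolding sum_negf[symmetric] exp_sum[OF fin(1)] ee by (simp only: minus_divide_left)
      moreover have "(\<Prod>i\<in>I2. exp (- (cmod (d i z))\<^sup>2)) = exp (- (\<Sum>i\<in>I2. (cmod (d i z))\<^sup>2))"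
        unfolding sum_negf[symmetric] exp_sum[OF fin(2)] ..
      moreover have "exp (- ln (1 / w (s F))) = w (s F)"
        using w(2)[OF F] by (simp add: ln_div)
      ultimately show ?thesis
        by (simp only: g_def minus_add_distrib exp_add)
    qed
    finally show ?thesis .
  qed
  have g0: "g F z \<ge> 0" if "F \<in> \<Omega>" for F z
    using w(2,3)[OF that] P by (auto simp: g_def intro!: add_nonneg_nonneg sum_nonneg)
  have dm [measurable]: "d i \<in> borel_measurable ?N" if "i \<in> I2" for i
    unfolding d_def using that l by (intro borel_measurable_diff borel_measurable_sum borel_measurable_times
        borel_measurable_const measurable_noise_component) (auto simp: I2_def)
  have xm [measurable]: "(\<lambda>z. z i) \<in> borel_measurable ?N" if "i \<in> I1" for i
    using that l by (intro measurable_noise_component) (auto simp: I1_def)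
  have gm [measurable]: "g F \<in> borel_measurable ?N" for F
    unfolding g_def by measurable
  \<comment> \<open>Off \<open>G F\<close> the left side is 0. On \<open>G F\<close> the likelihood
    of the guesses is \<open>exp (- g F z)\<close>, and \<open>g0\<close> ensures that
    \<open>ennreal\<close> does not truncate \<open>g F z\<close>.\<close>
  have pt: "ennreal (1 + a) * indicator (G F) z \<le>
      ennreal (exp a) * (indicator {z. \<forall>k<K. dc k (\<lambda>t\<in>{..<T}. x F (k, t) + z (k, t)) = F k} z * E F z) + ennreal (g F z)"
    if F: "F \<in> \<Omega>" for F z
  proof (cases "z \<in> G F")
    case True
    then have "indicator {z. \<forall>k<K. dc k (\<lambda>t\<in>{..<T}. x F (k, t) + z (k, t)) = F k} z = (1 :: ennreal)"
      by (simp add: G_def)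
    moreover have "ennreal (1 + a) \<le> ennreal (exp a * exp (- g F z) + g F z)"
      by (intro ennreal_leI one_plus_le_exp_tangent)
    ultimately show ?thesis
      using True g0[OF F] by (simp add: E_eq[OF F] ennreal_plus ennreal_mult)
  qed simp
  have int_g: "(\<integral>\<^sup>+ z. ennreal (g F z) \<partial>?N) \<le>
      ennreal (ln (1 / w (s F)) + (\<Sum>i\<in>I1. ln P + (2 * (cmod (x F i - c i))\<^sup>2 + 8) / P) +
      real T * (\<Sum>k\<in>{l..<K}. 8 + 8 * real l * (\<Sum>j<l. (cmod (C k j))\<^sup>2)))" if F: "F \<in> \<Omega>" for F
  proof -
    have w1: "ln (1 / w (s F)) \<ge> 0" using w(2,3)[OF F] by simp
    have "(\<integral>\<^sup>+ z. ennreal (g F z) \<partial>?N) = (\<integral>\<^sup>+ z. ennreal (ln (1 / w (s F))) +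
        (\<Sum>i\<in>I1. ennreal (ln P) + ennreal (1 / P) * ennreal ((cmod (x F i - c i + z i))\<^sup>2)) + (\<Sum>i\<in>I2. ennreal ((cmod (d i z))\<^sup>2)) \<partial>?N)"
      unfolding g_def using P w1
      by (intro nn_integral_cong)
        (simp add: ennreal_plus sum_ennreal[symmetric] sum_nonneg ennreal_mult'[symmetric] add.commute add_diff_eq diff_add_eq del: sum_ennreal)
    also have "\<dots> = ennreal (ln (1 / w (s F))) +
        (\<Sum>i\<in>I1. ennreal (ln P) + ennreal (1 / P) * (\<integral>\<^sup>+ z. ennreal ((cmod (x F i - c i + z i))\<^sup>2) \<partial>?N)) +
        (\<Sum>i\<in>I2. \<integral>\<^sup>+ z. ennreal ((cmod (d i z))\<^sup>2) \<partial>?N)"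
      by (simp add: nn_integral_add nn_integral_cmult nn_integral_sum emeasure_space_1 del: sum_ennreal)
    also have "\<dots> \<le> ennreal (ln (1 / w (s F))) +
        (\<Sum>i\<in>I1. ennreal (ln P) + ennreal (1 / P) * ennreal (2 * (cmod (x F i - c i))\<^sup>2 + 8)) +
        (\<Sum>i\<in>I2. ennreal (8 + 8 * real l * (\<Sum>j<l. (cmod (C (fst i) j))\<^sup>2)))"
    proof (intro add_mono sum_mono mult_left_mono order_refl)
      fix i assume "i \<in> I1"
      then show "(\<integral>\<^sup>+ z. ennreal ((cmod (x F i - c i + z i))\<^sup>2) \<partial>?N) \<le> ennreal (2 * (cmod (x F i - c i))\<^sup>2 + 8)"
        using l nn_integral_noise_shift_le[of "fst i" K "snd i" T "x F i - c i"] by (auto simp: I1_def)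
    next
      fix i assume "i \<in> I2"
      then show "(\<integral>\<^sup>+ z. ennreal ((cmod (d i z))\<^sup>2) \<partial>?N) \<le> ennreal (8 + 8 * real l * (\<Sum>j<l. (cmod (C (fst i) j))\<^sup>2))"
        using l nn_integral_noise_combination_le[of "fst i" K "snd i" T l "C (fst i)"] by (auto simp: I2_def d_def)
    qed auto
    also have "\<dots> = ennreal (ln (1 / w (s F)) + (\<Sum>i\<in>I1. ln P + (2 * (cmod (x F i - c i))\<^sup>2 + 8) / P) +
        (\<Sum>i\<in>I2. 8 + 8 * real l * (\<Sum>j<l. (cmod (C (fst i) j))\<^sup>2)))"
    proof -
      have f0: "0 \<le> ln P + (2 * q\<^sup>2 + 8) / P" for q
        using P by (intro add_nonneg_nonneg divide_nonneg_nonneg) auto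
      have h0: "0 \<le> 8 + 8 * real l * (\<Sum>j<l. (cmod (C (fst i) j))\<^sup>2)" for i :: "nat \<times> nat"
        by (intro add_nonneg_nonneg mult_nonneg_nonneg sum_nonneg) auto
      have "ennreal (ln P) + ennreal (1 / P) * ennreal (2 * q\<^sup>2 + 8) = ennreal (ln P + (2 * q\<^sup>2 + 8) / P)" for q
        using P by (subst ennreal_mult'[symmetric], simp, subst ennreal_plus[symmetric]) auto
      then show ?thesis
        using w1 by (simp add: f0 h0 sum_nonneg ennreal_plus[symmetric] del: ennreal_plus)
    qed
    also have "(\<Sum>i\<in>I2. 8 + 8 * real l * (\<Sum>j<l. (cmod (C (fst i) j))\<^sup>2)) =
        real T * (\<Sum>k\<in>{l..<K}. 8 + 8 * real l * (\<Sum>j<l. (cmod (C k j))\<^sup>2))"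
      unfolding I2_def by (subst sum.cartesian_product') (simp add: sum_distrib_left)
    finally show ?thesis .
  qed
  let ?R = "\<lambda>F. ln (1 / w (s F)) + (\<Sum>i\<in>I1. ln P + (2 * (cmod (x F i - c i))\<^sup>2 + 8) / P) +
      real T * (\<Sum>k\<in>{l..<K}. 8 + 8 * real l * (\<Sum>j<l. (cmod (C k j))\<^sup>2))"
  have R0: "?R F \<ge> 0" if "F \<in> \<Omega>" for F
    using w(2,3)[OF that] P by (auto intro!: add_nonneg_nonneg sum_nonneg mult_nonneg_nonneg)
  have Em: "(\<lambda>z. indicator {z. \<forall>k<K. dc k (\<lambda>t\<in>{..<T}. x F (k, t) + z (k, t)) = F k} z * E F z) \<in> borel_measurable ?N"
    if "F \<in> \<Omega>" for F
  proof -
    have "(\<lambda>z. indicator (G F) z * ennreal (exp (- g F z))) \<in> borel_measurable ?N" by measurable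
    then show ?thesis
      by (rule subst[OF measurable_cong, rotated]) (auto simp: E_eq[OF that] G_def indicator_def)
  qed
  have "ennreal ((1 + a) * (\<Sum>F\<in>\<Omega>. measure ?N (G F))) = (\<Sum>F\<in>\<Omega>. \<integral>\<^sup>+ z. ennreal (1 + a) * indicator (G F) z \<partial>?N)"
  proof -
    have "(\<integral>\<^sup>+ z. ennreal (1 + a) * indicator (G F) z \<partial>?N) = ennreal ((1 + a) * measure ?N (G F))" for F
      using a by (subst nn_integral_cmult_indicator[OF Gm]) (simp only: emeasure_eq_measure, subst ennreal_mult', auto)
    then show ?thesis
      using a by (simp only: sum_distrib_left) (rule sum_ennreal[symmetric], simp)
  qed
  also have "\<dots> \<le> (\<Sum>F\<in>\<Omega>. \<integral>\<^sup>+ z. ennreal (exp a) * (indicator {z. \<forall>k<K. dc k (\<lambda>t\<in>{..<T}. x F (k, t) + z (k, t)) = F k} z * E F z) + ennreal (g F z) \<partial>?N)"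
    by (intro sum_mono nn_integral_mono pt)
  also have "\<dots> = ennreal (exp a) * (\<Sum>F\<in>\<Omega>. \<integral>\<^sup>+ z. indicator {z. \<forall>k<K. dc k (\<lambda>t\<in>{..<T}. x F (k, t) + z (k, t)) = F k} z * E F z \<partial>?N) + (\<Sum>F\<in>\<Omega>. \<integral>\<^sup>+ z. ennreal (g F z) \<partial>?N)"
  proof -
    have "(\<integral>\<^sup>+ z. ennreal (exp a) * (indicator {z. \<forall>k<K. dc k (\<lambda>t\<in>{..<T}. x F (k, t) + z (k, t)) = F k} z * E F z) + ennreal (g F z) \<partial>?N) =
        ennreal (exp a) * (\<integral>\<^sup>+ z. indicator {z. \<forall>k<K. dc k (\<lambda>t\<in>{..<T}. x F (k, t) + z (k, t)) = F k} z * E F z \<partial>?N) +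
        (\<integral>\<^sup>+ z. ennreal (g F z) \<partial>?N)" if "F \<in> \<Omega>" for F
    proof -
      note m = Em[OF that]
      note m1 = borel_measurable_times_ennreal[OF borel_measurable_const[of "ennreal (exp a)"] m]
      show ?thesis
        unfolding nn_integral_add[OF m1 measurable_compose[OF gm measurable_ennreal]] nn_integral_cmult[OF m] ..
    qed
    then show ?thesis
      unfolding sum_distrib_left sum.distrib[symmetric] by (rule sum.cong[OF refl])
  qed
  also have "\<dots> \<le> ennreal (exp a) * of_nat (card (erase {..<K} ` \<Omega>)) + (\<Sum>F\<in>\<Omega>. ennreal (?R F))"
    unfolding E_def using P
    by (intro add_mono mult_left_mono sum_mono int_g decoding_weight_le \<Omega> l w dc) auto
  also have "\<dots> = ennreal (exp a * real (card (erase {..<K} ` \<Omega>)) + (\<Sum>F\<in>\<Omega>. ?R F))"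
  proof -
    have "(\<Sum>F\<in>\<Omega>. ennreal (?R F)) = ennreal (\<Sum>F\<in>\<Omega>. ?R F)"
      by (rule sum_ennreal) (rule R0)
    moreover have "ennreal (exp a) * of_nat (card (erase {..<K} ` \<Omega>)) = ennreal (exp a * real (card (erase {..<K} ` \<Omega>)))"
      by (simp add: ennreal_mult' ennreal_of_nat_eq_real_of_nat)
    ultimately show ?thesis
      using sum_nonneg[of \<Omega> ?R, OF R0] by (simp only: ennreal_plus[symmetric] mult_nonneg_nonneg exp_ge_zero of_nat_0_le_iff)
  qed
  finally have "(1 + a) * (\<Sum>F\<in>\<Omega>. measure ?N (G F)) \<le> exp a * real (card (erase {..<K} ` \<Omega>)) + (\<Sum>F\<in>\<Omega>. ?R F)"
    using sum_nonneg[of \<Omega> ?R, OF R0] by (subst (asm) ennreal_le_iff) auto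
  then show ?thesis unfolding G_def I1_def .
qed

section \<open>Converse for a caching policy\<close>

definition files :: "nat \<Rightarrow> nat \<Rightarrow> (nat \<Rightarrow> nat) set" where
  "files N L = PiE_dflt {..<N} 0 (\<lambda>_. {1..2 ^ L})"

lemma finite_files [simp]: "finite (files N L)"
  unfolding files_def by (intro finite_PiE_dflt) auto

lemma card_files: "card (files N L) = 2 ^ (L * N)"
  unfolding files_def by (simp add: card_PiE_dflt power_mult)

lemma files_nonempty [simp]: "files N L \<noteq> {}"
  by (simp add: files_def)

lemma file_pmf_eq: "file_pmf N L = pmf_of_set (files N L)"
  unfolding file_pmf_def files_def by (rule Pi_pmf_of_set) auto

lemma expectation_file_pmf:
  fixes f :: "_ \<Rightarrow> 'b :: {banach, second_countable_topology}"
  shows "measure_pmf.expectation (file_pmf N L) f = (\<Sum>F\<in>files N L. f F) /\<^sub>R real (card (files N L))"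
  unfolding file_pmf_eq
  by (subst integral_measure_pmf[of "files N L"]) (auto simp: set_pmf_of_set divide_inverse scaleR_sum_right[symmetric])

lemma card_erase_files_le:
  assumes "K \<le> N"
  shows "card (erase {..<K} ` files N L) \<le> 2 ^ (L * (N - K))"
proof -
  have "erase {..<K} ` files N L \<subseteq> PiE_dflt {K..<N} 0 (\<lambda>_. {1..2 ^ L})"
    by (auto simp: erase_def files_def PiE_dflt_def)
  then have "card (erase {..<K} ` files N L) \<le> card (PiE_dflt {K..<N} 0 (\<lambda>_. {1..2 ^ L}) :: (nat \<Rightarrow> nat) set)"
    by (intro card_mono finite_PiE_dflt) auto
  also have "\<dots> = 2 ^ (L * (N - K))"
    by (simp add: card_PiE_dflt power_mult)
  finally show ?thesis .
qed

definition cache_pmf :: "policy \<Rightarrow> nat \<Rightarrow> nat \<Rightarrow> nat pmf" where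
  "cache_pmf pol L m = map_pmf (cache pol m) (pmf_of_set {1..2 ^ L})"

lemma set_pmf_cache_pmf: "set_pmf (cache_pmf pol L m) = cache pol m ` {1..2 ^ L}"
  by (simp add: cache_pmf_def set_pmf_of_set)

text \<open>A single file is uniform under \<open>file_pmf\<close>, so the cached content has law
  \<open>cache_pmf\<close> and the average of its negative log-probability is its entropy;
  \<open>ln 2\<close> converts bits to nats. This is where the cache constraint enters the mean of
  \<open>g\<close>.\<close>

lemma sum_files_neg_ln_cache:
  assumes "n < N"
  shows "(\<Sum>F\<in>files N L. - ln (pmf (cache_pmf pol L m) (cache pol m (F n)))) =
    real (card (files N L)) * (ln 2 * pmf_entropy_bits (cache_pmf pol L m))"
proof -
  let ?p = "cache_pmf pol L m"
  have "map_pmf (\<lambda>F. cache pol m (F n)) (file_pmf N L) = map_pmf (cache pol m) (map_pmf (\<lambda>F. F n) (file_pmf N L))"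
    by (simp add: pmf.map_comp comp_def)
  also have "map_pmf (\<lambda>F. F n) (file_pmf N L) = pmf_of_set {1..2 ^ L}"
    using assms unfolding file_pmf_def by (subst Pi_pmf_component) auto
  finally have p: "map_pmf (\<lambda>F. cache pol m (F n)) (file_pmf N L) = ?p"
    by (simp add: cache_pmf_def)
  have "(\<Sum>F\<in>files N L. - ln (pmf ?p (cache pol m (F n)))) /\<^sub>R real (card (files N L)) =
      measure_pmf.expectation (file_pmf N L) (\<lambda>F. - ln (pmf ?p (cache pol m (F n))))"
    by (rule expectation_file_pmf[symmetric])
  also have "\<dots> = measure_pmf.expectation ?p (\<lambda>v. - ln (pmf ?p v))"
    by (subst p[symmetric]) (simp add: integral_map_pmf)
  also have "\<dots> = (\<Sum>v\<in>set_pmf ?p. - ln (pmf ?p v) * pmf ?p v)"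
    by (rule integral_measure_pmf_real) (auto simp: set_pmf_cache_pmf)
  also have "\<dots> = ln 2 * pmf_entropy_bits ?p"
    unfolding pmf_entropy_bits_def by (simp add: log_def sum_negf sum_distrib_left mult.commute)
  finally show ?thesis
    by (simp add: card_files divide_simps)
qed

text \<open>The weights are a product of marginals, although contents of one file at several nodes
  are dependent: the receiver is free to guess them independently, and only a total weight of at
  most 1 matters. The contents that occur lie in the product of the supports, where the weights sum
  to 1.\<close>

lemma sum_cache_guess_le_one:
  assumes "finite A" "\<And>i F. i \<in> A \<Longrightarrow> F \<in> \<Omega> \<Longrightarrow> F (snd i) \<in> {1..2 ^ L}" "finite \<Omega>"
  shows "(\<Sum>\<sigma>\<in>(\<lambda>F. \<lambda>i\<in>A. cache pol (fst i) (F (snd i))) ` \<Omega>. \<Prod>i\<in>A. pmf (cache_pmf pol L (fst i)) (\<sigma> i)) \<le> 1"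
proof -
  have "(\<Sum>\<sigma>\<in>(\<lambda>F. \<lambda>i\<in>A. cache pol (fst i) (F (snd i))) ` \<Omega>. \<Prod>i\<in>A. pmf (cache_pmf pol L (fst i)) (\<sigma> i)) \<le>
      (\<Sum>\<sigma>\<in>PiE A (\<lambda>i. set_pmf (cache_pmf pol L (fst i))). \<Prod>i\<in>A. pmf (cache_pmf pol L (fst i)) (\<sigma> i))"
    using assms by (intro sum_mono2 finite_PiE prod_nonneg) (auto simp: set_pmf_cache_pmf)
  also have "\<dots> = (\<Prod>i\<in>A. \<Sum>v\<in>set_pmf (cache_pmf pol L (fst i)). pmf (cache_pmf pol L (fst i)) v)"
    using assms by (subst prod_sum_PiE) (auto simp: set_pmf_cache_pmf)
  also have "\<dots> = 1"
    by (intro prod.neutral ballI sum_pmf_eq_1) (auto simp: set_pmf_cache_pmf)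
  finally show ?thesis .
qed

definition signal :: "policy \<Rightarrow> nat \<Rightarrow> nat \<Rightarrow> (nat \<Rightarrow> nat) \<Rightarrow> (nat \<times> nat \<Rightarrow> complex) \<Rightarrow> (nat \<Rightarrow> nat) \<Rightarrow> nat \<times> nat \<Rightarrow> complex" where
  "signal pol M N D H F = (\<lambda>(k, t). \<Sum>m<M. H (k, m) * enc pol m (cache_content pol N m F) D H t)"

lemma received_eq_signal:
  "received pol M N k F D H z = (\<lambda>t\<in>{..<blocklen pol D H}. signal pol M N D H F (k, t) + z (k, t))"
  by (simp add: received_def signal_def)

text \<open>Inputs of different nodes are correlated through the common files, so variances cannot
  simply be added. Cauchy-Schwarz over the nodes gives the factor \<open>M\<close> instead, which is
  harmless because it does not grow with the power.\<close>

lemma signal_variance_le: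
  assumes P: "\<And>m. m < M \<Longrightarrow> cvariance (map_pmf (\<lambda>F. enc pol m (cache_content pol N m F) D H t) (file_pmf N L)) \<le> P"
    and c_def: "c = measure_pmf.expectation (file_pmf N L) (\<lambda>F. signal pol M N D H F (k, t))"
  shows "(\<Sum>F\<in>files N L. (cmod (signal pol M N D H F (k, t) - c))\<^sup>2) \<le>
    real (card (files N L)) * (real M * (\<Sum>m<M. (cmod (H (k, m)))\<^sup>2) * P)"
proof -
  let ?X = "\<lambda>m F. enc pol m (cache_content pol N m F) D H t"
  let ?n = "real (card (files N L))"
  define \<mu> where "\<mu> = (\<lambda>m. measure_pmf.expectation (file_pmf N L) (?X m))"
  have n: "?n > 0" by (simp add: card_files)
  have c: "c = (\<Sum>m<M. H (k, m) * \<mu> m)"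
    unfolding c_def \<mu>_def signal_def expectation_file_pmf
    by (simp add: scaleR_conv_of_real sum_distrib_left sum.swap[of _ "files N L"] mult_ac)
  have var: "(\<Sum>F\<in>files N L. (cmod (?X m F - \<mu> m))\<^sup>2) \<le> ?n * P" if "m < M" for m
  proof -
    have "cvariance (map_pmf (?X m) (file_pmf N L)) = measure_pmf.expectation (file_pmf N L) (\<lambda>F. (cmod (?X m F - \<mu> m))\<^sup>2)"
      unfolding cvariance_def \<mu>_def by (simp add: integral_map_pmf)
    also have "\<dots> = (\<Sum>F\<in>files N L. (cmod (?X m F - \<mu> m))\<^sup>2) / ?n"
      by (simp add: expectation_file_pmf divide_inverse mult.commute)
    finally have "(\<Sum>F\<in>files N L. (cmod (?X m F - \<mu> m))\<^sup>2) / ?n \<le> P"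
      using P[OF that] by simp
    then show ?thesis
      using n by (simp add: pos_divide_le_eq mult.commute)
  qed
  have "(\<Sum>F\<in>files N L. (cmod (signal pol M N D H F (k, t) - c))\<^sup>2) \<le>
      (\<Sum>F\<in>files N L. real M * (\<Sum>m<M. (cmod (H (k, m)))\<^sup>2 * (cmod (?X m F - \<mu> m))\<^sup>2))"
  proof (rule sum_mono)
    fix F
    have "signal pol M N D H F (k, t) - c = (\<Sum>m<M. H (k, m) * (?X m F - \<mu> m))"
      by (simp add: signal_def c right_diff_distrib sum_subtractf)
    then show "(cmod (signal pol M N D H F (k, t) - c))\<^sup>2 \<le> real M * (\<Sum>m<M. (cmod (H (k, m)))\<^sup>2 * (cmod (?X m F - \<mu> m))\<^sup>2)"
      using cmod_sum_square_le[of "{..<M}" "\<lambda>m. H (k, m) * (?X m F - \<mu> m)"]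
      by (simp add: norm_mult power_mult_distrib)
  qed
  also have "\<dots> = real M * (\<Sum>m<M. (cmod (H (k, m)))\<^sup>2 * (\<Sum>F\<in>files N L. (cmod (?X m F - \<mu> m))\<^sup>2))"
    by (simp add: sum_distrib_left sum.swap[of _ "files N L"])
  also have "\<dots> \<le> real M * (\<Sum>m<M. (cmod (H (k, m)))\<^sup>2 * (?n * P))"
    by (intro mult_left_mono sum_mono var) auto
  also have "\<dots> = ?n * (real M * (\<Sum>m<M. (cmod (H (k, m)))\<^sup>2) * P)"
    by (simp add: sum_distrib_left sum_distrib_right mult_ac)
  finally show ?thesis .
qed

text \<open>
  The contribution of the nodes m \<ge> l to the signal of user k minus the combination C k j of the
  signals of the users j < l. The map \<sigma> supplies the cached contents of the files l, ..., K - 1,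
  and \<rho> the other files.
\<close>

definition side_signal ::
  "policy \<Rightarrow> nat \<Rightarrow> nat \<Rightarrow> nat \<Rightarrow> nat \<Rightarrow> (nat \<Rightarrow> nat) \<Rightarrow> (nat \<times> nat \<Rightarrow> complex) \<Rightarrow> (nat \<Rightarrow> nat \<Rightarrow> complex)
    \<Rightarrow> (nat \<Rightarrow> nat) \<Rightarrow> (nat \<times> nat \<Rightarrow> nat) \<Rightarrow> nat \<times> nat \<Rightarrow> complex" where
  "side_signal pol M N K l D H C \<rho> \<sigma> = (\<lambda>(k, t). \<Sum>m\<in>{l..<M}. (H (k, m) - (\<Sum>j<l. C k j * H (j, m))) *
    enc pol m (\<lambda>n\<in>{..<N}. if n \<in> {l..<K} then \<sigma> (m, n) else cache pol m (\<rho> n)) D H t)"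

text \<open>For \<open>m < l\<close> the coefficient of the input of node \<open>m\<close> vanishes
  by \<open>rel\<close>. For the remaining nodes the cache is rebuilt file by file, from the known
  files through the caching map and from the guess for the files in \<open>{l..<K}\<close>. This
  rebuilding is possible because there is no coding across files.\<close>

lemma signal_eq_combination:
  assumes rel: "\<And>m. m < l \<Longrightarrow> H (k, m) = (\<Sum>j<l. C k j * H (j, m))" and l: "l \<le> M"
  shows "signal pol M N D H F (k, t) = (\<Sum>j<l. C k j * signal pol M N D H F (j, t)) +
    side_signal pol M N K l D H C (erase {l..<K} F) (\<lambda>i\<in>{l..<M} \<times> {l..<K}. cache pol (fst i) (F (snd i))) (k, t)"
proof -
  let ?X = "\<lambda>m. enc pol m (cache_content pol N m F) D H t"
  have "(\<lambda>n\<in>{..<N}. if n \<in> {l..<K} then (\<lambda>i\<in>{l..<M} \<times> {l..<K}. cache pol (fst i) (F (snd i))) (m, n)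
      else cache pol m (erase {l..<K} F n)) = cache_content pol N m F" if "m \<in> {l..<M}" for m
    using that by (auto simp: cache_content_def erase_def restrict_def fun_eq_iff)
  then have side: "side_signal pol M N K l D H C (erase {l..<K} F) (\<lambda>i\<in>{l..<M} \<times> {l..<K}. cache pol (fst i) (F (snd i))) (k, t)
      = (\<Sum>m\<in>{l..<M}. (H (k, m) - (\<Sum>j<l. C k j * H (j, m))) * ?X m)"
    unfolding side_signal_def prod.case by (intro sum.cong refl) (simp only:)
  have split: "(\<Sum>m<M. f m) = (\<Sum>m<l. f m) + (\<Sum>m\<in>{l..<M}. f m)" for f :: "nat \<Rightarrow> complex"
    using l by (simp add: lessThan_atLeast0 sum.atLeastLessThan_concat)
  have "(\<Sum>j<l. C k j * signal pol M N D H F (j, t)) = (\<Sum>m<M. (\<Sum>j<l. C k j * H (j, m)) * ?X m)"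
    unfolding signal_def by (simp add: sum_distrib_left sum_distrib_right sum.swap[of _ "{..<l}"] mult.assoc)
  also have "\<dots> = (\<Sum>m<l. H (k, m) * ?X m) + (\<Sum>m\<in>{l..<M}. (\<Sum>j<l. C k j * H (j, m)) * ?X m)"
    unfolding split using rel by simp
  finally show ?thesis
    unfolding side signal_def by (simp add: split left_diff_distrib sum_subtractf)
qed

text \<open>The coefficient of the block length that does not grow with P.\<close>

definition overhead :: "nat \<Rightarrow> nat \<Rightarrow> nat \<Rightarrow> (nat \<times> nat \<Rightarrow> complex) \<Rightarrow> (nat \<Rightarrow> nat \<Rightarrow> complex) \<Rightarrow> real" where
  "overhead M K l H C = (\<Sum>k<l. 2 * (real M * (\<Sum>m<M. (cmod (H (k, m)))\<^sup>2)) + 8) +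
    (\<Sum>k\<in>{l..<K}. 8 + 8 * real l * (\<Sum>j<l. (cmod (C k j))\<^sup>2))"

lemma overhead_nonneg: "overhead M K l H C \<ge> 0"
  unfolding overhead_def by (intro add_nonneg_nonneg sum_nonneg mult_nonneg_nonneg) auto

text \<open>Union bound over the users; the factor \<open>K\<close> is fixed while \<open>Pe\<close>
  tends to 0. The chosen demand makes user \<open>k\<close> want file \<open>k\<close>, so that all
  \<open>K\<close> requests are distinct.\<close>

lemma measure_all_correct_ge:
  fixes H :: "nat \<times> nat \<Rightarrow> complex"
  assumes valid: "valid_policy M K N \<mu> \<nu> P L pol" and KN: "1 \<le> K" "K \<le> N" and D: "D = (\<lambda>k\<in>{..<K}. k)"
  defines "W \<equiv> noise_measure K (blocklen pol D H)"
  shows "real (card (files N L)) * (1 - real K * Pe pol M K N L H) \<le>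
    (\<Sum>F\<in>files N L. measure W {z \<in> space W. \<forall>k<K. dec pol k (received pol M N k F D H z) D H = F k})"
proof -
  interpret W: prob_space W unfolding W_def by (rule prob_space_noise)
  let ?bad = "\<lambda>k F. {z \<in> space W. dec pol k (received pol M N k F D H z) D H \<noteq> F (D k)}"
  let ?good = "\<lambda>F. {z \<in> space W. \<forall>k<K. dec pol k (received pol M N k F D H z) D H = F k}"
  have Dd: "D \<in> demands K N" using KN by (auto simp: D demands_def)
  have meas: "?bad k F \<in> sets W" if k: "k < K" for k F
  proof -
    have dm: "(\<lambda>Y. dec pol k Y D H) \<in> measurable (PiM {..<blocklen pol D H} (\<lambda>_. borel)) (count_space UNIV)"
      using valid k Dd by (auto simp: valid_policy_def)
    have "(\<lambda>z. received pol M N k F D H z) \<in> measurable W (PiM {..<blocklen pol D H} (\<lambda>_. borel))"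
      unfolding received_eq_signal W_def using k
      by (intro measurable_restrict borel_measurable_add borel_measurable_const measurable_noise_component) auto
    from measurable_sets[OF measurable_compose[OF this dm], of "- {F (D k)}"]
    show ?thesis by (simp add: vimage_def Int_def conj_commute)
  qed
  have good: "measure W (?good F) \<ge> 1 - (\<Sum>k<K. measure W (?bad k F))" for F
  proof -
    have eq: "?good F = space W - (\<Union>k\<in>{..<K}. ?bad k F)"
      by (auto simp: D)
    have "measure W (\<Union>k\<in>{..<K}. ?bad k F) \<le> (\<Sum>k<K. measure W (?bad k F))"
      using meas by (intro W.finite_measure_subadditive_finite) auto
    moreover have "measure W (?good F) = 1 - measure W (\<Union>k\<in>{..<K}. ?bad k F)"
      unfolding eq using meas by (intro W.prob_compl sets.finite_UN) auto
    ultimately show ?thesis by simp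
  qed
  have "finite (demands K N \<times> {..<K})"
    unfolding demands_def by (intro finite_cartesian_product finite_PiE) auto
  then have err: "error_prob pol M K N L k D H \<le> Pe pol M K N L H" if "k < K" for k
    unfolding Pe_def using that Dd
    by (intro Max_ge finite_imageI) (auto intro!: image_eqI[where x = "(D, k)"])
  have n: "real (card (files N L)) > 0" by (simp add: card_files)
  have "(\<Sum>F\<in>files N L. measure W (?bad k F)) = real (card (files N L)) * error_prob pol M K N L k D H" for k
    unfolding error_prob_def W_def[symmetric] expectation_file_pmf using n by simp
  then have "(\<Sum>F\<in>files N L. \<Sum>k<K. measure W (?bad k F)) = real (card (files N L)) * (\<Sum>k<K. error_prob pol M K N L k D H)"
    by (subst sum.swap) (simp add: sum_distrib_left)
  also have "\<dots> \<le> real (card (files N L)) * (real K * Pe pol M K N L H)"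
    using sum_mono[of "{..<K}" "\<lambda>k. error_prob pol M K N L k D H" "\<lambda>_. Pe pol M K N L H"] err
    by (intro mult_left_mono) auto
  finally have "real (card (files N L)) * (1 - real K * Pe pol M K N L H) \<le>
      (\<Sum>F\<in>files N L. 1 - (\<Sum>k<K. measure W (?bad k F)))"
    by (simp add: sum_subtractf right_diff_distrib)
  also have "\<dots> \<le> (\<Sum>F\<in>files N L. measure W (?good F))"
    by (intro sum_mono good)
  finally show ?thesis .
qed

text \<open>Instance of \<open>one_shot_converse\<close> divided by the number of file tuples. The
  guess likelihood contributes the 1, the cache constraint the term with \<open>\<mu>\<close>, and
  the power constraint makes the quadratic terms of the early users bounded after division by
  \<open>P\<close>.\<close>

lemma policy_converse:
  assumes valid: "valid_policy M K N \<mu> \<nu> P L pol" and KN: "1 \<le> K" "K \<le> N"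
    and l: "l \<le> M" "l \<le> K" and P: "P \<ge> 1"
    and H: "H \<in> space (chan_measure M K \<nu>)"
    and rel: "\<And>k m. m < l \<Longrightarrow> H (k, m) = (\<Sum>j<l. C k j * H (j, m))"
    and D: "D = (\<lambda>k\<in>{..<K}. k)"
  shows "real K * real L * ln 2 * (1 - real K * Pe pol M K N L H) \<le>
    1 + real (M - l) * real (K - l) * \<mu> * real L * ln 2 + real (blocklen pol D H) * (real l * ln P + overhead M K l H C)"
proof -
  define T where "T = blocklen pol D H"
  define A where "A = {l..<M} \<times> {l..<K}"
  let ?\<Omega> = "files N L"
  let ?n = "real (card ?\<Omega>)"
  define s where "s = (\<lambda>F. \<lambda>i\<in>A. cache pol (fst i) (F (snd i)))"
  define w where "w = (\<lambda>\<sigma>. \<Prod>i\<in>A. pmf (cache_pmf pol L (fst i)) (\<sigma> i))"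
  define x where "x = signal pol M N D H"
  define c where "c = (\<lambda>i. measure_pmf.expectation (file_pmf N L) (\<lambda>F. x F i))"
  define S where "S = (\<lambda>k. real M * (\<Sum>m<M. (cmod (H (k, m)))\<^sup>2))"
  define Q where "Q = (\<Sum>k\<in>{l..<K}. 8 + 8 * real l * (\<Sum>j<l. (cmod (C k j))\<^sup>2))"
  \<comment> \<open>The number of requested bits in nats: \<open>exp a\<close> is 2^(L K), exactly
    the number of possible requested files, so it compensates the small success probability of the
    guesses.\<close>
  define a where "a = real K * real L * ln 2"
  define p where "p = (\<Sum>F\<in>?\<Omega>. measure (noise_measure K T)
      {z \<in> space (noise_measure K T). \<forall>k<K. dec pol k (\<lambda>t\<in>{..<T}. x F (k, t) + z (k, t)) D H = F k})"
  have Dd: "D \<in> demands K N" using KN by (auto simp: D demands_def)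
  have n: "?n > 0" by (simp add: card_files)
  have finA: "finite A" by (simp add: A_def)
  have inF: "F (snd i) \<in> {1..2 ^ L}" if "F \<in> ?\<Omega>" "i \<in> A" for F i
    using that KN by (auto simp: files_def PiE_dflt_def A_def)
  have wpos: "pmf (cache_pmf pol L (fst i)) (s F i) > 0" if "F \<in> ?\<Omega>" "i \<in> A" for F i
    using inF[OF that] that by (auto simp: s_def pmf_positive_iff set_pmf_cache_pmf)
  have a0: "a \<ge> 0" by (simp add: a_def)
  have one: "(1 + a) * p \<le> exp a * real (card (erase {..<K} ` ?\<Omega>)) +
    (\<Sum>F\<in>?\<Omega>. ln (1 / w (s F)) + (\<Sum>i\<in>{..<l} \<times> {..<T}. ln P + (2 * (cmod (x F i - c i))\<^sup>2 + 8) / P) + real T * Q)"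
    unfolding p_def Q_def
  proof (rule one_shot_converse[where dc = "\<lambda>k Y. dec pol k Y D H" and e = "side_signal pol M N K l D H C"])
    show "(\<lambda>Y. dec pol k Y D H) \<in> measurable (PiM {..<T} (\<lambda>_. borel)) (count_space UNIV)" if "k < K" for k
      using valid that Dd by (auto simp: valid_policy_def T_def)
    show "(\<Sum>\<sigma>\<in>s ` ?\<Omega>. w \<sigma>) \<le> 1"
      unfolding s_def w_def using finA inF by (intro sum_cache_guess_le_one) auto
    show "w (s F) > 0" if "F \<in> ?\<Omega>" for F
      unfolding w_def using wpos[OF that] by (intro prod_pos) auto
    show "x F (k, t) = (\<Sum>j<l. C k j * x F (j, t)) + side_signal pol M N K l D H C (erase {l..<K} F) (s F) (k, t)" for F k t
      unfolding x_def s_def A_def using rel l by (intro signal_eq_combination) auto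
  qed (use l P a0 in \<open>auto simp: w_def intro!: prod_nonneg prod_le_1 pmf_le_1\<close>)
  have ent: "(\<Sum>F\<in>?\<Omega>. ln (1 / w (s F))) \<le> ?n * (real (M - l) * real (K - l) * \<mu> * real L * ln 2)"
  proof -
    have "(\<Sum>F\<in>?\<Omega>. ln (1 / w (s F))) = (\<Sum>F\<in>?\<Omega>. \<Sum>i\<in>A. - ln (pmf (cache_pmf pol L (fst i)) (cache pol (fst i) (F (snd i)))))"
    proof (rule sum.cong[OF refl])
      fix F assume F: "F \<in> ?\<Omega>"
      have "pmf (cache_pmf pol L (fst i)) (s F i) \<noteq> 0" if "i \<in> A" for i
        using wpos[OF F that] by linarith
      then have "ln (w (s F)) = (\<Sum>i\<in>A. ln (pmf (cache_pmf pol L (fst i)) (s F i)))"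
        unfolding w_def using finA by (intro ln_prod) auto
      moreover have "w (s F) > 0"
        unfolding w_def using wpos[OF F] by (intro prod_pos) auto
      ultimately show "ln (1 / w (s F)) = (\<Sum>i\<in>A. - ln (pmf (cache_pmf pol L (fst i)) (cache pol (fst i) (F (snd i)))))"
        by (simp add: ln_div sum_negf s_def)
    qed
    also have "\<dots> = (\<Sum>i\<in>A. ?n * (ln 2 * pmf_entropy_bits (cache_pmf pol L (fst i))))"
      using KN by (subst sum.swap, intro sum.cong refl sum_files_neg_ln_cache) (auto simp: A_def)
    also have "\<dots> \<le> (\<Sum>i\<in>A. ?n * (ln 2 * (\<mu> * real L)))"
      using valid by (intro sum_mono mult_left_mono) (auto simp: valid_policy_def cache_pmf_def A_def)
    also have "\<dots> = ?n * (real (M - l) * real (K - l) * \<mu> * real L * ln 2)"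
      by (simp add: A_def)
    finally show ?thesis .
  qed
  have pow: "(\<Sum>F\<in>?\<Omega>. \<Sum>i\<in>{..<l} \<times> {..<T}. ln P + (2 * (cmod (x F i - c i))\<^sup>2 + 8) / P) \<le>
      ?n * (real T * (real l * ln P + (\<Sum>k<l. 2 * S k + 8)))"
  proof -
    have "(\<Sum>F\<in>?\<Omega>. ln P + (2 * (cmod (x F i - c i))\<^sup>2 + 8) / P) \<le> ?n * (ln P + 2 * S (fst i) + 8)"
      if il: "i \<in> {..<l} \<times> {..<T}" for i
    proof -
      from il obtain k t where i: "i = (k, t)" "k < l" "t < T" by auto
      have "cvariance (map_pmf (\<lambda>F. enc pol m (cache_content pol N m F) D H t) (file_pmf N L)) \<le> P" if "m < M" for m
        using valid Dd H i that by (auto simp: valid_policy_def T_def)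
      then have var: "(\<Sum>F\<in>?\<Omega>. (cmod (x F i - c i))\<^sup>2) \<le> ?n * (S k * P)"
        unfolding x_def c_def i S_def by (intro signal_variance_le[OF _ refl])
      have "(\<Sum>F\<in>?\<Omega>. ln P + (2 * (cmod (x F i - c i))\<^sup>2 + 8) / P) =
          ?n * ln P + (2 * (\<Sum>F\<in>?\<Omega>. (cmod (x F i - c i))\<^sup>2) + ?n * 8) / P"
        by (simp add: sum.distrib sum_distrib_left sum_divide_distrib add_divide_distrib)
      \<comment> \<open>Since \<open>P\<close> is at least 1, 8 is replaced by \<open>8 * P\<close>;
        both quadratic contributions then become constants after division by
        \<open>P\<close>.\<close>
      also have "\<dots> \<le> ?n * ln P + (2 * (?n * (S k * P)) + ?n * (8 * P)) / P"
        using var P n by (intro add_left_mono divide_right_mono add_mono mult_left_mono) auto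
      also have "\<dots> = ?n * (ln P + 2 * S (fst i) + 8)"
        using P by (simp add: i field_simps)
      finally show ?thesis .
    qed
    then have "(\<Sum>i\<in>{..<l} \<times> {..<T}. \<Sum>F\<in>?\<Omega>. ln P + (2 * (cmod (x F i - c i))\<^sup>2 + 8) / P) \<le>
        (\<Sum>i\<in>{..<l} \<times> {..<T}. ?n * (ln P + 2 * S (fst i) + 8))"
      by (intro sum_mono)
    also have "\<dots> = (\<Sum>k<l. real T * (?n * (ln P + 2 * S k + 8)))"
      by (subst sum.cartesian_product') simp
    also have "\<dots> = ?n * (real T * (real l * ln P + (\<Sum>k<l. 2 * S k + 8)))"
      by (simp add: sum.distrib sum_distrib_left distrib_left mult_ac)
    finally show ?thesis by (subst sum.swap)
  qed
  have ex: "exp a * real (card (erase {..<K} ` ?\<Omega>)) \<le> ?n"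
  proof -
    have "exp a = 2 ^ (L * K)"
      using exp_of_nat_mult[of "L * K" "ln (2 :: real)"] by (simp add: a_def mult_ac)
    moreover have "real (card (erase {..<K} ` ?\<Omega>)) \<le> real (2 ^ (L * (N - K)))"
      using card_erase_files_le[OF KN(2)] by (rule of_nat_mono)
    ultimately have "exp a * real (card (erase {..<K} ` ?\<Omega>)) \<le> 2 ^ (L * K) * 2 ^ (L * (N - K))"
      by simp
    also have "\<dots> = ?n"
      using KN by (simp add: card_files power_add[symmetric] distrib_left[symmetric])
    finally show ?thesis .
  qed
  have lower: "?n * (1 - real K * Pe pol M K N L H) \<le> p"
    using measure_all_correct_ge[OF valid KN D, of H] unfolding p_def T_def x_def received_eq_signal by simp
  have p0: "p \<ge> 0" unfolding p_def by (intro sum_nonneg) auto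
  have "a * (?n * (1 - real K * Pe pol M K N L H)) \<le> a * p"
    using lower a0 by (rule mult_left_mono)
  \<comment> \<open>Dropping the additional \<open>p\<close> loses a bounded amount per file tuple,
    negligible against \<open>a\<close>, which is proportional to \<open>L\<close>.\<close>
  also have "\<dots> \<le> (1 + a) * p" using p0 by (simp add: distrib_right)
  also have "\<dots> \<le> ?n + (?n * (real (M - l) * real (K - l) * \<mu> * real L * ln 2) +
      ?n * (real T * (real l * ln P + (\<Sum>k<l. 2 * S k + 8))) + ?n * (real T * Q))"
    using one ex ent pow by (simp add: sum.distrib)
  also have "\<dots> = ?n * (1 + real (M - l) * real (K - l) * \<mu> * real L * ln 2 + real T * (real l * ln P + overhead M K l H C))"
    by (simp add: overhead_def S_def Q_def algebra_simps)
  finally have "?n * (a * (1 - real K * Pe pol M K N L H)) \<le>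
      ?n * (1 + real (M - l) * real (K - l) * \<mu> * real L * ln 2 + real T * (real l * ln P + overhead M K l H C))"
    by (simp add: mult.left_commute)
  then show ?thesis
    using n by (simp add: a_def T_def)
qed

section \<open>Rank of the channel matrix\<close>

text \<open>Fubini with coordinate \<open>i\<close> innermost. As \<open>f\<close> ignores that
  coordinate, each slice of the exceptional set lies in a single point, which is null for
  \<open>\<nu>\<close>.\<close>

lemma AE_PiM_component_neq:
  fixes \<nu> :: "complex measure" and f :: "('i \<Rightarrow> complex) \<Rightarrow> complex"
  assumes \<nu>: "prob_space \<nu>" "sets \<nu> = sets borel" "\<And>c. emeasure \<nu> {c} = 0"
    and I: "finite I" "i \<in> I"
    and f: "f \<in> borel_measurable (PiM I (\<lambda>_. \<nu>))"
    and indep: "\<And>x y. f (x(i := y)) = f x"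
  shows "AE x in PiM I (\<lambda>_. \<nu>). x i \<noteq> f x"
proof (rule AE_I)
  interpret \<nu>: prob_space \<nu> by fact
  interpret product_sigma_finite "\<lambda>_ :: 'i. \<nu>"
    by (simp add: product_sigma_finite_def \<nu>.sigma_finite_measure_axioms)
  note [measurable_cong] = \<nu>(2)
  let ?J = "I - {i}"
  have ins: "insert i ?J = I" using I by auto
  have comp: "(\<lambda>x. x i) \<in> borel_measurable (PiM I (\<lambda>_. \<nu>))"
    using measurable_component_singleton[OF I(2), of "\<lambda>_. \<nu>"] by (simp add: measurable_cong_sets[OF refl \<nu>(2)])
  show meas: "{x \<in> space (PiM I (\<lambda>_. \<nu>)). x i = f x} \<in> sets (PiM I (\<lambda>_. \<nu>))"
  proof -
    note [measurable] = comp f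
    show ?thesis by measurable
  qed
  let ?A = "{x \<in> space (PiM I (\<lambda>_. \<nu>)). x i = f x}"
  have "emeasure (PiM I (\<lambda>_. \<nu>)) ?A = (\<integral>\<^sup>+ x. indicator ?A x \<partial>PiM (insert i ?J) (\<lambda>_. \<nu>))"
    unfolding ins by (rule nn_integral_indicator[OF meas, symmetric])
  also have "\<dots> = (\<integral>\<^sup>+ x. \<integral>\<^sup>+ y. indicator ?A (x(i := y)) \<partial>\<nu> \<partial>PiM ?J (\<lambda>_. \<nu>))"
    by (intro product_nn_integral_insert, unfold ins) (use I meas in simp_all)
  also have "\<dots> \<le> (\<integral>\<^sup>+ x. \<integral>\<^sup>+ y. indicator {f x} y \<partial>\<nu> \<partial>PiM ?J (\<lambda>_. \<nu>))"
    by (intro nn_integral_mono) (auto simp: indicator_def indep)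
  also have "\<dots> = 0"
    using \<nu> by simp
  finally show "emeasure (PiM I (\<lambda>_. \<nu>)) ?A = 0" by simp
qed auto

text \<open>Gaussian elimination without pivoting: the rows of H, restricted to the first l columns, are
  written in terms of the first l rows, provided the pivots met on the way do not vanish.\<close>

fun elim :: "nat \<Rightarrow> (nat \<times> nat \<Rightarrow> complex) \<Rightarrow> nat \<Rightarrow> nat \<Rightarrow> complex" where
  "elim 0 H k j = 0"
| "elim (Suc l) H k j =
    (let q = (H (k, l) - (\<Sum>i<l. elim l H k i * H (i, l))) / (H (l, l) - (\<Sum>i<l. elim l H l i * H (i, l)))
     in if j = l then q else elim l H k j - q * elim l H l j)"

text \<open>The hypothesis says that all pivots are nonzero. In the induction step the old relation
  for row \<open>k\<close> is corrected by a multiple of the old relation for row \<open>l\<close>.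
  On earlier columns the correction is zero, and on column \<open>l\<close> the quotient is chosen
  to make it exact.\<close>

lemma elim_combination:
  assumes "\<And>i. i < l \<Longrightarrow> H (i, i) \<noteq> (\<Sum>j<i. elim i H i j * H (j, i))" "m < l"
  shows "H (k, m) = (\<Sum>j<l. elim l H k j * H (j, m))"
  using assms
proof (induction l arbitrary: k m)
  case 0
  then show ?case by simp
next
  case (Suc l)
  \<comment> \<open>The residual of column \<open>l\<close> after elimination of the earlier
    columns; \<open>r l\<close> is the new pivot.\<close>
  define r where "r = (\<lambda>k. H (k, l) - (\<Sum>i<l. elim l H k i * H (i, l)))"
  have rl: "r l \<noteq> 0" using Suc.prems(1)[of l] by (simp add: r_def)
  have "(\<Sum>j<Suc l. elim (Suc l) H k j * H (j, m)) =
      (\<Sum>j<l. (elim l H k j - r k / r l * elim l H l j) * H (j, m)) + r k / r l * H (l, m)"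
    by (simp add: r_def)
  also have "\<dots> = (\<Sum>j<l. elim l H k j * H (j, m)) + r k / r l * (H (l, m) - (\<Sum>j<l. elim l H l j * H (j, m)))"
    by (simp add: left_diff_distrib sum_subtractf sum_distrib_left mult.assoc right_diff_distrib)
  also have "\<dots> = H (k, m)"
  proof (cases "m = l")
    case True
    then have "H (l, m) - (\<Sum>j<l. elim l H l j * H (j, m)) = r l"
      "(\<Sum>j<l. elim l H k j * H (j, m)) = H (k, m) - r k" by (simp_all add: r_def)
    with rl show ?thesis by simp
  next
    case False
    then have "H (k, m) = (\<Sum>j<l. elim l H k j * H (j, m))" for k
      using Suc.prems by (intro Suc.IH) auto
    from this[of k] this[of l] show ?thesis by simp
  qed
  finally show ?case by simp
qed

text \<open>Elimination to depth \<open>l\<close> reads only columns below \<open>l\<close>. Hence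
  the value that the diagonal entry in column \<open>i\<close> must avoid is independent of that
  entry, as the null-set argument requires.\<close>

lemma elim_cong:
  assumes "\<And>i m. m < l \<Longrightarrow> H (i, m) = H' (i, m)"
  shows "elim l H k j = elim l H' k j"
  using assms
proof (induction l arbitrary: k j)
  case (Suc l)
  then have "elim l H k j = elim l H' k j" for k j by simp
  with Suc.prems show ?case by (simp add: Let_def)
qed simp

lemma measurable_elim:
  assumes "k < K" "l \<le> K" "l \<le> M"
  shows "(\<lambda>H. elim l H k j) \<in> borel_measurable (PiM ({..<K} \<times> {..<M}) (\<lambda>_. borel))"
  using assms
proof (induction l arbitrary: k j)
  case (Suc l)
  have IH: "(\<lambda>H. elim l H k j) \<in> borel_measurable (PiM ({..<K} \<times> {..<M}) (\<lambda>_. borel))" if "k < K" for k j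
    using that Suc.prems by (intro Suc.IH) auto
  have comp: "(\<lambda>H. H (k, m)) \<in> borel_measurable (PiM ({..<K} \<times> {..<M}) (\<lambda>_. borel :: complex measure))" if "k < K" "m < M" for k m
    using that by (intro measurable_component_singleton) auto
  show ?case
    unfolding elim.simps Let_def if_distrib using Suc.prems
    by (cases "j = l")
      (auto intro!: borel_measurable_diff borel_measurable_divide borel_measurable_sum borel_measurable_times IH comp)
qed simp

text \<open>Each of the \<open>l\<close> pivots vanishes only on a null set, since its diagonal
  entry would have to equal a function of other entries. Explicit elimination provides measurable
  coefficients and needs no determinants.\<close>

lemma AE_elim_combination:
  assumes \<nu>: "prob_space \<nu>" "sets \<nu> = sets borel" "\<And>c. emeasure \<nu> {c} = 0"
    and l: "l \<le> K" "l \<le> M"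
  shows "AE H in chan_measure M K \<nu>. \<forall>k m. m < l \<longrightarrow> H (k, m) = (\<Sum>j<l. elim l H k j * H (j, m))"
proof -
  have "AE H in chan_measure M K \<nu>. H (i, i) \<noteq> (\<Sum>j<i. elim i H i j * H (j, i))" if "i < l" for i
    unfolding chan_measure_def
  proof (rule AE_PiM_component_neq[OF \<nu>])
    have eq: "sets (PiM ({..<K} \<times> {..<M}) (\<lambda>_. \<nu>)) = sets (PiM ({..<K} \<times> {..<M}) (\<lambda>_. borel :: complex measure))"
      by (intro sets_PiM_cong refl \<nu>(2))
    show "(\<lambda>H. \<Sum>j<i. elim i H i j * H (j, i)) \<in> borel_measurable (PiM ({..<K} \<times> {..<M}) (\<lambda>_. \<nu>))"
      unfolding measurable_cong_sets[OF eq refl] using that l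
      by (intro borel_measurable_sum borel_measurable_times measurable_elim measurable_component_singleton) auto
    show "(\<Sum>j<i. elim i (H((i, i) := y)) i j * (H((i, i) := y)) (j, i)) = (\<Sum>j<i. elim i H i j * H (j, i))" for H y
      by (intro sum.cong refl arg_cong2[where f = "(*)"] elim_cong) auto
  qed (use that l in auto)
  then have "AE H in chan_measure M K \<nu>. \<forall>i\<in>{..<l}. H (i, i) \<noteq> (\<Sum>j<i. elim i H i j * H (j, i))"
    by (intro AE_finite_allI) auto
  then show ?thesis
    by eventually_elim (auto intro: elim_combination)
qed

section \<open>Asymptotics\<close>

text \<open>\<open>policy_converse\<close> divided by \<open>L\<close> and solved for the block
  length. The error term and the isolated 1 vanish in the limit. The channel is fixed here, so the
  overhead is a constant.\<close>

lemma blocklen_rate_ge: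
  assumes feas: "feasible M K N \<mu> \<nu> P pol" and KN: "1 \<le> K" "K \<le> N" and l: "1 \<le> l" "l \<le> M" "l \<le> K" and P: "P > 1"
    and H: "H \<in> space (chan_measure M K \<nu>)"
    and Pe: "(\<lambda>L. Pe (pol L) M K N L H) \<longlonglongrightarrow> 0"
    and rel: "\<And>k m. m < l \<Longrightarrow> H (k, m) = (\<Sum>j<l. C k j * H (j, m))"
    and D: "D = (\<lambda>k\<in>{..<K}. k)"
  shows "ennreal (ln 2 * (real K - real (M - l) * real (K - l) * \<mu>) / (real l * ln P + overhead M K l H C)) \<le>
    liminf (\<lambda>L. ennreal (real (blocklen (pol L) D H) / real L))"
proof -
  let ?q = "real l * ln P + overhead M K l H C"
  let ?b = "\<lambda>L. (ln 2 * (real K * (1 - real K * Pe (pol L) M K N L H) - real (M - l) * real (K - l) * \<mu>) - inverse (real L)) / ?q"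
  have q: "?q > 0"
    using l P overhead_nonneg[of M K l H C] by (intro add_pos_nonneg mult_pos_pos) auto
  have "?b \<longlonglongrightarrow> (ln 2 * (real K * (1 - real K * 0) - real (M - l) * real (K - l) * \<mu>) - 0) / ?q"
    using q by (intro tendsto_intros Pe lim_inverse_n) auto
  then have "(\<lambda>L. ennreal (?b L)) \<longlonglongrightarrow> ennreal (ln 2 * (real K - real (M - l) * real (K - l) * \<mu>) / ?q)"
    by (intro tendsto_ennrealI) simp
  then have "ennreal (ln 2 * (real K - real (M - l) * real (K - l) * \<mu>) / ?q) = liminf (\<lambda>L. ennreal (?b L))"
    by (intro lim_imp_Liminf[symmetric]) auto
  also have "\<dots> \<le> liminf (\<lambda>L. ennreal (real (blocklen (pol L) D H) / real L))"
  proof (rule Liminf_mono, use eventually_ge_at_top[of 1] in eventually_elim)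
    fix L :: nat assume L: "1 \<le> L"
    have "valid_policy M K N \<mu> \<nu> P L (pol L)"
      using feas by (simp add: feasible_def)
    from policy_converse[OF this KN l(2,3) _ H rel D] P
    have "real K * real L * ln 2 * (1 - real K * Pe (pol L) M K N L H) \<le>
        1 + real (M - l) * real (K - l) * \<mu> * real L * ln 2 + real (blocklen (pol L) D H) * ?q"
      by simp
    then have "(ln 2 * (real K * (1 - real K * Pe (pol L) M K N L H) - real (M - l) * real (K - l) * \<mu>) - inverse (real L)) * real L
        \<le> real (blocklen (pol L) D H) * ?q"
      using L by (simp add: algebra_simps)
    then have "?b L \<le> real (blocklen (pol L) D H) / real L"
      using q L by (simp add: divide_simps mult.commute)
    then show "ennreal (?b L) \<le> ennreal (real (blocklen (pol L) D H) / real L)"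
      by (rule ennreal_leI)
  qed
  finally show ?thesis .
qed

text \<open>The delivery time is a maximum over demands of a limit superior, so it dominates the
  limit inferior for the single demand \<open>D\<close>, the form that Fatou's lemma
  provides.\<close>

lemma liminf_rate_le_delivery_time:
  assumes D: "D \<in> demands K N"
    and meas: "\<And>L. blocklen (pol L) D \<in> measurable (chan_measure M K \<nu>) (count_space UNIV)"
  shows "enn2ereal (liminf (\<lambda>L. \<integral>\<^sup>+ H. ennreal (real (blocklen (pol L) D H) / real L) \<partial>chan_measure M K \<nu>))
    \<le> delivery_time M K N \<nu> pol"
proof -
  let ?I = "\<lambda>D L. \<integral>\<^sup>+ H. ennreal (real (blocklen (pol L) D H)) \<partial>chan_measure M K \<nu>"
  let ?J = "\<lambda>L. \<integral>\<^sup>+ H. ennreal (real (blocklen (pol L) D H) / real L) \<partial>chan_measure M K \<nu>"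
  \<comment> \<open>The case \<open>L\<close> = 0 would divide by zero; it is irrelevant to the
    limit.\<close>
  have eq: "enn2ereal (?J L) \<le> enn2ereal (?I D L) / ereal (real L)" if "L \<ge> 1" for L
  proof -
    have "?I D L = (\<integral>\<^sup>+ H. ennreal (real L) * ennreal (real (blocklen (pol L) D H) / real L) \<partial>chan_measure M K \<nu>)"
      using that by (intro nn_integral_cong) (simp add: ennreal_mult'[symmetric] del: ennreal_mult_divide_eq)
    also have "\<dots> = ennreal (real L) * ?J L"
      by (intro nn_integral_cmult measurable_compose[OF meas]) auto
    finally have "enn2ereal (?I D L) = ereal (real L) * enn2ereal (?J L)"
      by (simp add: times_ennreal.rep_eq)
    then show ?thesis
      using that enn2ereal_nonneg[of "?J L"] by (cases "enn2ereal (?J L)") auto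
  qed
  have "enn2ereal (liminf ?J) = liminf (\<lambda>L. enn2ereal (?J L))"
    by (intro Liminf_compose_continuous_mono[symmetric] continuous_on_enn2ereal)
       (auto simp: mono_def less_eq_ennreal.rep_eq)
  also have "\<dots> \<le> liminf (\<lambda>L. enn2ereal (?I D L) / ereal (real L))"
    by (rule Liminf_mono, use eventually_ge_at_top[of 1] in eventually_elim) (rule eq)
  also have "\<dots> \<le> limsup (\<lambda>L. enn2ereal (?I D L) / ereal (real L))"
    by (rule Liminf_le_Limsup) simp
  also have "\<dots> \<le> delivery_time M K N \<nu> pol"
    unfolding delivery_time_def using D
    by (intro Max_ge finite_imageI) (auto simp: demands_def intro: finite_PiE)
  finally show ?thesis .
qed

lemma achievable_NDT_ge:
  assumes KN: "1 \<le> K" "K \<le> N" and l: "1 \<le> l" "l \<le> M" "l \<le> K"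
    and \<nu>: "prob_space \<nu>" "sets \<nu> = sets borel" "absolutely_continuous lborel \<nu>"
    and ach: "achievable_NDT M K N \<mu> \<nu> \<delta>"
  shows "ereal ((real K - real (M - l) * real (K - l) * \<mu>) / real l) \<le> \<delta>"
proof -
  define D where "D = (\<lambda>k\<in>{..<K}. k)"
  have D: "D \<in> demands K N" using KN by (auto simp: D_def demands_def)
  define A where "A = real K - real (M - l) * real (K - l) * \<mu>"
  let ?\<H> = "chan_measure M K \<nu>"
  interpret prob_space ?\<H>
    unfolding chan_measure_def by (intro prob_space_PiM \<nu>(1))
  have null: "emeasure \<nu> {c} = 0" for c
  proof -
    have "{c} \<in> null_sets lborel" by (simp add: null_sets_def)
    with \<nu>(3) show ?thesis by (auto simp: absolutely_continuous_def)
  qed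
  from ach obtain pol where feas: "\<And>P. P > 0 \<Longrightarrow> feasible M K N \<mu> \<nu> P (pol P)"
    and lim: "((\<lambda>P. delivery_time M K N \<nu> (pol P) * ereal (log 2 P)) \<longlongrightarrow> \<delta>) at_top"
    unfolding achievable_NDT_def by blast
  \<comment> \<open>At these powers the normalising factor \<open>log 2 P\<close> is exactly
    \<open>n\<close>.\<close>
  define \<pi> where "\<pi> = (\<lambda>n :: nat. pol (2 ^ n))"
  have feas': "feasible M K N \<mu> \<nu> (2 ^ n) (\<pi> n)" for n
    unfolding \<pi>_def by (rule feas) simp
  have meas: "blocklen (\<pi> n L) D \<in> measurable ?\<H> (count_space UNIV)" for n L
    using feas'[of n] D by (auto simp: feasible_def valid_policy_def)
  define rate where "rate = (\<lambda>n L H. ennreal (real (blocklen (\<pi> n L) D H) / real L))"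
  have rm [measurable]: "rate n L \<in> borel_measurable ?\<H>" for n L
    unfolding rate_def by (intro measurable_compose[OF meas]) auto
  define u where "u = (\<lambda>n H. ennreal (real n) * liminf (\<lambda>L. rate n L H))"
  have lm: "(\<lambda>H. liminf (\<lambda>L. rate n L H)) \<in> borel_measurable ?\<H>" for n
    by (intro borel_measurable_liminf rm)
  have um: "u n \<in> borel_measurable ?\<H>" for n
    unfolding u_def by (intro borel_measurable_times_ennreal borel_measurable_const lm)
  have "AE H in ?\<H>. \<forall>n. (\<lambda>L. Pe (\<pi> n L) M K N L H) \<longlonglongrightarrow> 0"
    using feas' by (subst AE_all_countable) (auto simp: feasible_def)
  moreover have "AE H in ?\<H>. \<forall>k m. m < l \<longrightarrow> H (k, m) = (\<Sum>j<l. elim l H k j * H (j, m))"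
    using l by (intro AE_elim_combination \<nu> null) auto
  ultimately have ae: "AE H in ?\<H>. ennreal (A / real l) \<le> liminf (\<lambda>n. u n H)"
    using AE_space
  proof eventually_elim
    case (elim H)
    let ?c = "overhead M K l H (elim l H)"
    \<comment> \<open>This is \<open>n\<close> times the rate bound at power 2^n, with numerator and
      denominator divided by \<open>n\<close>. The channel-dependent overhead thus tends to 0 for
      each fixed \<open>H\<close>, and the limit no longer depends on \<open>H\<close>.\<close>
    let ?v = "\<lambda>n :: nat. ln 2 * A / (real l * ln 2 + ?c * inverse (real n))"
    have "?v \<longlonglongrightarrow> ln 2 * A / (real l * ln 2 + ?c * 0)"
      using l by (intro tendsto_intros lim_inverse_n) auto
    then have "(\<lambda>n. ennreal (?v n)) \<longlonglongrightarrow> ennreal (A / real l)"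
      by (intro tendsto_ennrealI) simp
    then have "ennreal (A / real l) = liminf (\<lambda>n. ennreal (?v n))"
      by (intro lim_imp_Liminf[symmetric]) auto
    also have "\<dots> \<le> liminf (\<lambda>n. u n H)"
    proof (rule Liminf_mono, use eventually_ge_at_top[of 1] in eventually_elim)
      fix n :: nat assume n: "1 \<le> n"
      have "ennreal (?v n) = ennreal (real n) * ennreal (ln 2 * A / (real l * ln (2 ^ n) + ?c))"
        using n by (simp add: ennreal_mult'[symmetric] ln_realpow field_simps)
      also have "\<dots> \<le> u n H"
        unfolding u_def rate_def A_def using n elim
        by (intro mult_left_mono blocklen_rate_ge[OF feas' KN l]) (auto simp: D_def)
      finally show "ennreal (?v n) \<le> u n H" .
    qed
    finally show ?case .
  qed
  have "ennreal (A / real l) = (\<integral>\<^sup>+ H. ennreal (A / real l) \<partial>?\<H>)"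
    by (simp add: emeasure_space_1)
  also have "\<dots> \<le> (\<integral>\<^sup>+ H. liminf (\<lambda>n. u n H) \<partial>?\<H>)"
    by (rule nn_integral_mono_AE[OF ae])
  also have "\<dots> \<le> liminf (\<lambda>n. \<integral>\<^sup>+ H. u n H \<partial>?\<H>)"
    by (rule nn_integral_liminf[OF um])
  finally have "ennreal (A / real l) \<le> liminf (\<lambda>n. \<integral>\<^sup>+ H. u n H \<partial>?\<H>)" .
  then have "enn2ereal (ennreal (A / real l)) \<le> enn2ereal (liminf (\<lambda>n. \<integral>\<^sup>+ H. u n H \<partial>?\<H>))"
    by (simp add: less_eq_ennreal.rep_eq)
  also have "\<dots> = liminf (\<lambda>n. enn2ereal (\<integral>\<^sup>+ H. u n H \<partial>?\<H>))"
    by (intro Liminf_compose_continuous_mono[symmetric] continuous_on_enn2ereal)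
       (auto simp: mono_def less_eq_ennreal.rep_eq)
  also have "\<dots> \<le> liminf (\<lambda>n. delivery_time M K N \<nu> (\<pi> n) * ereal (log 2 (2 ^ n)))"
  proof (intro Liminf_mono always_eventually allI)
    fix n
    have "(\<integral>\<^sup>+ H. u n H \<partial>?\<H>) = ennreal (real n) * (\<integral>\<^sup>+ H. liminf (\<lambda>L. rate n L H) \<partial>?\<H>)"
      unfolding u_def by (rule nn_integral_cmult[OF lm])
    also have "\<dots> \<le> ennreal (real n) * liminf (\<lambda>L. \<integral>\<^sup>+ H. rate n L H \<partial>?\<H>)"
      by (intro mult_left_mono nn_integral_liminf rm) auto
    finally have "enn2ereal (\<integral>\<^sup>+ H. u n H \<partial>?\<H>) \<le> enn2ereal (ennreal (real n) * liminf (\<lambda>L. \<integral>\<^sup>+ H. rate n L H \<partial>?\<H>))"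
      by (simp add: less_eq_ennreal.rep_eq)
    also have "\<dots> = enn2ereal (liminf (\<lambda>L. \<integral>\<^sup>+ H. rate n L H \<partial>?\<H>)) * ereal (real n)"
      by (simp add: times_ennreal.rep_eq mult.commute)
    also have "\<dots> \<le> delivery_time M K N \<nu> (\<pi> n) * ereal (real n)"
      unfolding rate_def by (intro ereal_mult_right_mono liminf_rate_le_delivery_time D meas) auto
    also have "real n = log 2 (2 ^ n)" by (simp add: log_nat_power)
    finally show "enn2ereal (\<integral>\<^sup>+ H. u n H \<partial>?\<H>) \<le> delivery_time M K N \<nu> (\<pi> n) * ereal (log 2 (2 ^ n))" .
  qed
  also have "\<dots> = \<delta>"
  proof (rule lim_imp_Liminf)
    have "filterlim (\<lambda>n :: nat. 2 ^ n :: real) at_top sequentially"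
      by (rule filterlim_at_top_mono[OF filterlim_real_sequentially])
         (auto intro!: always_eventually less_imp_le of_nat_less_two_power)
    from filterlim_compose[OF lim this]
    show "(\<lambda>n. delivery_time M K N \<nu> (\<pi> n) * ereal (log 2 (2 ^ n))) \<longlonglongrightarrow> \<delta>"
      by (simp add: \<pi>_def)
  qed simp
  finally have "enn2ereal (ennreal (A / real l)) \<le> \<delta>" .
  \<comment> \<open>For small \<open>l\<close> the bound may be negative. \<open>ennreal\<close>
    then truncates it to 0, which only strengthens what has been shown.\<close>
  moreover have "ereal (A / real l) \<le> enn2ereal (ennreal (A / real l))"
    by (cases "A / real l \<ge> 0") (auto simp: enn2ereal_ennreal ennreal_neg zero_ennreal.rep_eq)
  ultimately show ?thesis unfolding A_def by (rule order.trans[rotated])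
qed

theorem theorem1:
  fixes M K N :: nat and \<mu> :: real and \<nu> :: "complex measure"
  assumes "M \<ge> 1" and "K \<ge> 1" and "N \<ge> K"
    and "1 / real M \<le> \<mu>" and "\<mu> \<le> 1"
    and "prob_space \<nu>" and "sets \<nu> = sets borel" and "absolutely_continuous lborel \<nu>"
  shows "ereal (MAX l \<in> {1..min M K}.
            (real K - pos_part (real M - real l) * pos_part (real K - real l) * \<mu>) / real l)
         \<le> min_NDT M K N \<mu> \<nu>"
proof -
  let ?f = "\<lambda>l. (real K - pos_part (real M - real l) * pos_part (real K - real l) * \<mu>) / real l"
  have "Max (?f ` {1..min M K}) \<in> ?f ` {1..min M K}"
    using assms(1,2) by (intro Max_in) auto
  then obtain l where l: "l \<in> {1..min M K}" "Max (?f ` {1..min M K}) = ?f l" by blast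
  \<comment> \<open>As \<open>l\<close> is at most \<open>min M K\<close>, truncated subtraction on
    naturals and the positive part agree.\<close>
  then have pos: "pos_part (real M - real l) = real (M - l)" "pos_part (real K - real l) = real (K - l)"
    by (auto simp: pos_part_def)
  show ?thesis
    unfolding min_NDT_def l(2) pos
  proof (rule Inf_greatest)
    fix \<delta> assume "\<delta> \<in> {\<delta>. achievable_NDT M K N \<mu> \<nu> \<delta>}"
    then show "ereal ((real K - real (M - l) * real (K - l) * \<mu>) / real l) \<le> \<delta>"
      using assms l(1) by (intro achievable_NDT_ge) auto
  qed
qed

end
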